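(* Let $X=(X,d)$ be a metric space, let $a<b$ be real numbers, and let $p\in[1,\infty]$. A map $\gamma:[a,b]\to X$ belongs to the space $AC_p([a,b],X)$ if and only if $h\circ\gamma\in AC_p([a,b])$ for every Lipschitz function $h:X\to\mathbb{R}$.
   Context: For a metric space $(Y,\rho)$ and $p\in[1,\infty]$, $AC_p([a,b],Y)$ denotes the set of all maps $\gamma:[a,b]\to Y$ for which there is a nonnegative function $g\in L_p([a,b])$ (Lebesgue measure) such that $\rho(\gamma(t_1),\gamma(t_2))\le\int_{t_1}^{t_2}g(\tau)\,d\tau$ for all $a\le t_1\le t_2\le b$. One writes $AC_p([a,b]):=AC_p([a,b],\mathbb{R})$, where $\mathbb{R}$ carries the usual metric. A function $h:X\to\mathbb{R}$ is Lipschitz if there is $L>0$ with $|h(x)-h(y)|\le L\,d(x,y)$ for all $x,y\in X$. *)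

theory Defs
  imports "HOL-Analysis.Analysis"
begin

text \<open>
  Representatives of the elements of \<open>L_p([a,b])\<close> for an exponent \<open>p \<in> [1,\<infinity>]\<close>; only the
  values on \<open>{a..b}\<close> matter. For \<open>p = \<infinity>\<close> these are the essentially bounded functions.
\<close>

definition Lp :: "ennreal \<Rightarrow> real \<Rightarrow> real \<Rightarrow> (real \<Rightarrow> real) set" where
  "Lp p a b =
    {g. g \<in> borel_measurable (lebesgue_on {a..b}) \<and>
        (if p = \<infinity> then \<exists>C. AE t in lebesgue_on {a..b}. \<bar>g t\<bar> \<le> C
         else integrable (lebesgue_on {a..b}) (\<lambda>t. \<bar>g t\<bar> powr enn2real p))}"

text \<open>
  A map \<open>[a,b] \<rightarrow> Y\<close> is represented by a function on all of \<open>real\<close>, and membership depends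
  only on its restriction to \<open>{a..b}\<close>. As \<open>L_p([a,b]) \<subseteq> L_1([a,b])\<close> for \<open>p \<ge> 1\<close>, the Bochner
  integral below is a genuine one, not the default value \<open>0\<close> of a non-integrable function.
\<close>

definition AC :: "ennreal \<Rightarrow> real \<Rightarrow> real \<Rightarrow> (real \<Rightarrow> 'y::metric_space) set" where
  "AC p a b =
    {\<gamma>. \<exists>g \<in> Lp p a b. (\<forall>t\<in>{a..b}. 0 \<le> g t) \<and>
         (\<forall>t\<^sub>1 t\<^sub>2. a \<le> t\<^sub>1 \<and> t\<^sub>1 \<le> t\<^sub>2 \<and> t\<^sub>2 \<le> b \<longrightarrow>
            dist (\<gamma> t\<^sub>1) (\<gamma> t\<^sub>2) \<le> (LINT \<tau>:{t\<^sub>1..t\<^sub>2}|lebesgue. g \<tau>))}"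

end

theory Submission
  imports Defs
begin

text \<open>
  One direction is immediate: a Lipschitz function multiplies the dominating function by a constant.
  For the converse, composing with the functions \<open>dist \<cdot> z\<close> shows that \<open>\<gamma>\<close> is continuous, and
  each of them comes with its own dominating function in \<open>L_p\<close>. There are infinitely many of
  them, so what is missing is a single dominating function. It comes from three ideas.

  \<^item> \<^emph>\<open>Uniform boundedness\<close> (\<open>lipschitz_uniform_boundedness\<close>). Finite sums
    \<open>\<Sum> w\<^sub>j \<bar>h (\<gamma> x\<^sub>j) - h (\<gamma> y\<^sub>j)\<bar>\<close>, with the weights normalised in the exponent conjugate to \<open>p\<close>, are
    seminorms in \<open>h\<close>, bounded for each fixed Lipschitz \<open>h\<close> because \<open>h \<circ> \<gamma>\<close> lies in \<open>AC_p\<close>. Hence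
    they are bounded by one constant \<open>C\<close> for all 1-Lipschitz \<open>h\<close>.

  \<^item> \<^emph>\<open>One function sees all intervals\<close> (\<open>fine_oscillation\<close>). For finitely many intervals
    \<open>[s\<^sub>i, t\<^sub>i]\<close> there is one 2-Lipschitz function \<open>h\<close> such that, for every \<open>i\<close>, the variation of
    \<open>h \<circ> \<gamma>\<close> on \<open>[s\<^sub>i, t\<^sub>i]\<close> is, up to an arbitrarily small error, at least a fixed fraction of
    \<open>dist (\<gamma> s\<^sub>i) (\<gamma> t\<^sub>i)\<close>. The function
    \<open>dist \<cdot> (\<gamma> s\<^sub>i)\<close> would do for the single index \<open>i\<close>; the point is to patch these functions
    together. The arcs \<open>\<gamma> [s\<^sub>i, t\<^sub>i]\<close> cut the curve into cells, one for each set of arcs through a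
    point, and on each cell the best of the functions is used, folded into a sawtooth so small that
    its values on different cells do not conflict.

  \<^item> \<^emph>\<open>Passage to the limit.\<close> Together these bound \<open>\<Sum> (d\<^sub>i / \<delta>)\<^sup>p \<delta>\<close> uniformly over the
    partitions of \<open>[a,b]\<close> into intervals of equal length \<open>\<delta>\<close>, with \<open>d\<^sub>i\<close> the distances between
    the images of consecutive nodes (\<open>uniform_difference_quotient_bound\<close>). By Fatou, the lower limit \<open>G\<close> of
    the step functions \<open>d\<^sub>i / \<delta>\<close> lies in \<open>L_p\<close>. Each \<open>dist (\<gamma> \<cdot>) z\<close> is the integral of some
    function (Radon--Nikodym), which by Lebesgue differentiation is almost everywhere the limit of difference
    quotients and so at most \<open>G\<close> in absolute value. Hence \<open>G\<close> dominates \<open>\<gamma>\<close>.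

  For \<open>p = \<infinity>\<close> uniform boundedness alone, applied to difference quotients, makes \<open>\<gamma>\<close> Lipschitz.
\<close>

section \<open>Uniform boundedness on Lipschitz functions\<close>

text \<open>
  The Banach--Steinhaus theorem for the Lipschitz functions on a metric space, by a gliding hump.
  Were the seminorms unbounded on the 1-Lipschitz functions, one could pick \<open>T n\<close> of rapidly growing
  norm \<open>M (T n)\<close> together with nearly extremal \<open>F n\<close>, and sum \<open>\<plusminus> (1/3)\<^sup>n F n\<close>. The signs keep
  the contribution of \<open>F n\<close> from being cancelled by the earlier terms, and the tail of
  the series is too small to cancel it, so every \<open>T n\<close> is large at the sum.
\<close>

lemma lipschitz_uniform_boundedness:
  fixes \<Theta> :: "(('x::metric_space \<Rightarrow> real) \<Rightarrow> real) set"
  assumes add: "\<And>T f g. T \<in> \<Theta> \<Longrightarrow> T (\<lambda>x. f x + g x) \<le> T f + T g"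
    and scale: "\<And>T f c. T \<in> \<Theta> \<Longrightarrow> T (\<lambda>x. c * f x) = \<bar>c\<bar> * T f"
    and bdd: "\<And>T. T \<in> \<Theta> \<Longrightarrow> \<exists>B. \<forall>L f. L-lipschitz_on UNIV f \<longrightarrow> T f \<le> B * L"
    and ptw: "\<And>L f. L-lipschitz_on UNIV f \<Longrightarrow> \<exists>B. \<forall>T\<in>\<Theta>. T f \<le> B"
  shows "\<exists>C. \<forall>T\<in>\<Theta>. \<forall>f. 1-lipschitz_on UNIV f \<longrightarrow> T f \<le> C"
proof (rule ccontr)
  assume neg: "\<not> ?thesis"
  define M where "M T = (SUP f\<in>{f. 1-lipschitz_on UNIV f}. T f)" for T :: "('x \<Rightarrow> real) \<Rightarrow> real"
  have bA: "bdd_above (T ` {f. 1-lipschitz_on UNIV f})" if "T \<in> \<Theta>" for T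
    using bdd[OF that] by (fastforce simp: bdd_above_def)
  have M_ge: "T f \<le> M T" if "T \<in> \<Theta>" "1-lipschitz_on UNIV f" for T f
    unfolding M_def using bA[OF that(1)] that(2) by (intro cSUP_upper) auto
  have T0: "T (\<lambda>x. c) = 0" if T: "T \<in> \<Theta>" for T c
  proof -
    from bdd[OF T] obtain B where B: "\<And>L f. L-lipschitz_on UNIV f \<Longrightarrow> T f \<le> B * L" by blast
    have le: "T (\<lambda>x. d) \<le> 0" for d
      using B[of 0 "\<lambda>x. d"] lipschitz_on_constant[of UNIV d] by simp
    have "T (\<lambda>x. -1 * c) = \<bar>-1\<bar> * T (\<lambda>x. c)" by (rule scale[OF T])
    moreover have "T (\<lambda>x. c + (-1) * c) \<le> T (\<lambda>x. c) + T (\<lambda>x. -1 * c)" by (rule add[OF T])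
    moreover have "T (\<lambda>x. 0 * c) = 0" using scale[OF T, of 0 "\<lambda>x. c"] by simp
    ultimately show ?thesis using le[of c] by simp
  qed
  have Mlip: "T f \<le> M T * L" if T: "T \<in> \<Theta>" and f: "L-lipschitz_on UNIV f" and L: "0 < L" for T f L
  proof -
    have "1-lipschitz_on UNIV (\<lambda>x. (1 / L) * f x)"
      using lipschitz_on_cmult_real[OF f, of "1/L"] L by simp
    from M_ge[OF T this] have "T f / L \<le> M T" using scale[OF T, of "1/L" f] L by simp
    then show ?thesis using L by (simp add: pos_divide_le_eq)
  qed
  have "\<exists>T f. T \<in> \<Theta> \<and> 1-lipschitz_on UNIV f \<and> M T > 4 * 6 ^ Suc n \<and> 3/4 * M T \<le> T f" for n :: nat
  proof -
    from neg obtain T g where T: "T \<in> \<Theta>" and g: "1-lipschitz_on UNIV g" "T g > 4 * 6 ^ Suc n"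
      by (meson not_le_imp_less)
    have M1: "M T > 4 * 6 ^ Suc n" using M_ge[OF T g(1)] g(2) by linarith
    have M0: "0 < M T" using M1 by (smt (verit) zero_less_power)
    have "3/4 * M T < (SUP f\<in>{f. 1-lipschitz_on UNIV f}. T f)"
      using M0 by (simp add: M_def[symmetric])
    then obtain f where "1-lipschitz_on UNIV f" "3/4 * M T < T f"
      using g(1) bA[OF T] by (subst (asm) less_cSUP_iff) auto
    then show ?thesis using T M1 by force
  qed
  then obtain T F where T: "\<And>n. T n \<in> \<Theta>" and F: "\<And>n. 1-lipschitz_on UNIV (F n)"
    and M: "\<And>n. M (T n) > 4 * 6 ^ Suc n" and TF: "\<And>n. 3/4 * M (T n) \<le> T n (F n)"
    by metis
  obtain z :: 'x where True by blast
  \<comment> \<open>Normalising to vanish at \<open>z\<close> makes the series converge pointwise; constants do not affect \<open>T n\<close>.\<close>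
  define V where "V n x = (1/3) ^ Suc n * (F n x - F n z)" for n x
  define step where "step n Y = (if T n (\<lambda>x. Y x + V n x) \<ge> T n (V n) then (\<lambda>x. Y x + V n x) else (\<lambda>x. Y x - V n x))" for n Y
  define X where "X = rec_nat (\<lambda>x. 0) step"
  have X0: "X 0 = (\<lambda>x. 0)" and XS: "X (Suc n) = step n (X n)" for n by (auto simp: X_def)
  have TV: "T n (V n) \<ge> (1/3)^Suc n * (3/4 * M (T n))" for n
  proof -
    have "T n (\<lambda>x. (F n x - F n z) + F n z) \<le> T n (\<lambda>x. F n x - F n z) + T n (\<lambda>x. F n z)"
      by (rule add[OF T])
    then have "T n (F n) \<le> T n (\<lambda>x. F n x - F n z)" using T0[OF T] by simp
    moreover have "T n (V n) = (1/3)^Suc n * T n (\<lambda>x. F n x - F n z)"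
      unfolding V_def using scale[OF T, of n "(1/3)^Suc n" "\<lambda>x. F n x - F n z"] by simp
    moreover have "3/4 * M (T n) \<le> T n (\<lambda>x. F n x - F n z)" using TF[of n] calculation(1) by linarith
    ultimately show ?thesis by (simp only: mult_left_mono zero_le_power zero_le_divide_iff) simp
  qed
  have TX: "T n (X (Suc n)) \<ge> T n (V n)" for n
  proof (cases "T n (\<lambda>x. X n x + V n x) \<ge> T n (V n)")
    case True then show ?thesis by (simp add: XS step_def)
  next
    case False
    have "T n (\<lambda>x. 2 * V n x) = 2 * T n (V n)" using scale[OF T, of n 2 "V n"] by simp
    moreover have "T n (\<lambda>x. 2 * V n x) \<le> T n (\<lambda>x. X n x + V n x) + T n (\<lambda>x. -1 * (X n x - V n x))"
      using add[OF T, of n "\<lambda>x. X n x + V n x" "\<lambda>x. -1 * (X n x - V n x)"] by simp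
    moreover have "T n (\<lambda>x. -1 * (X n x - V n x)) = T n (\<lambda>x. X n x - V n x)"
      using scale[OF T, of n "-1" "\<lambda>x. X n x - V n x"] by simp
    ultimately show ?thesis using False by (simp add: XS step_def)
  qed
  have Vlip: "\<bar>V n x - V n y\<bar> \<le> (1/3)^Suc n * dist x y" for n x y
  proof -
    have "\<bar>F n x - F n y\<bar> \<le> dist x y" using lipschitz_onD[OF F, of x y n] by (simp add: dist_real_def)
    then have "(1/3)^Suc n * \<bar>F n x - F n y\<bar> \<le> (1/3)^Suc n * dist x y" by (intro mult_left_mono) auto
    moreover have "V n x - V n y = (1/3)^Suc n * (F n x - F n y)"
      unfolding V_def right_diff_distrib[symmetric] by simp
    moreover have "\<bar>(1/3)^Suc n * (F n x - F n y)\<bar> = (1/3)^Suc n * \<bar>F n x - F n y\<bar>"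
      by (subst abs_mult) simp
    ultimately show ?thesis by (simp only:)
  qed
  have Xd: "\<bar>(X (Suc n) x - X n x) - (X (Suc n) y - X n y)\<bar> \<le> (1/3)^Suc n * dist x y" for n x y
    using Vlip[of n x y] Vlip[of n y x] by (auto simp: XS step_def dist_commute[of y x])
  have Xz: "X n z = 0" for n
    by (induction n) (auto simp: X0 XS step_def V_def)
  \<comment> \<open>The geometric tail: the partial sums move by at most \<open>(1/3)^m / 2\<close> in Lipschitz norm after step \<open>m\<close>.\<close>
  have Xtail: "\<bar>(X (m + k) x - X m x) - (X (m + k) y - X m y)\<bar> \<le> ((1/3)^m - (1/3)^(m+k)) / 2 * dist x y" for m k x y
  proof (induction k)
    case (Suc k)
    have e: "((1/3)^m - (1/3)^(m+k)) / 2 * dist x y + (1/3)^Suc (m+k) * dist x y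
        = ((1/3)^m - (1/3)^(m+Suc k)) / 2 * dist x y"
      by (simp add: field_simps)
    have "\<bar>(X (m + Suc k) x - X m x) - (X (m + Suc k) y - X m y)\<bar>
        \<le> \<bar>(X (m + k) x - X m x) - (X (m + k) y - X m y)\<bar>
          + \<bar>(X (Suc (m + k)) x - X (m + k) x) - (X (Suc (m + k)) y - X (m + k) y)\<bar>"
      by simp
    then show ?case using Suc Xd[of "m+k" x y] e by linarith
  qed simp
  have Xtail': "\<bar>(X (m + k) x - X m x) - (X (m + k) y - X m y)\<bar> \<le> (1/3)^m / 2 * dist x y" for m k x y
  proof -
    have "((1/3)^m - (1/3)^(m+k)) / 2 * dist x y \<le> (1/3::real)^m / 2 * dist x y"
      by (intro mult_right_mono) auto
    then show ?thesis using Xtail[of m k x y] by linarith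
  qed
  have conv: "convergent (\<lambda>n. X n x)" for x
  proof -
    have "summable (\<lambda>n. X (Suc n) x - X n x)"
    proof (rule summable_comparison_test)
      show "\<exists>N. \<forall>n\<ge>N. norm (X (Suc n) x - X n x) \<le> (1/3)^n * dist x z"
      proof (intro exI allI impI)
        fix n
        have "(1/3)^Suc n * dist x z \<le> (1/3)^n * dist x z" by (intro mult_right_mono) auto
        then show "norm (X (Suc n) x - X n x) \<le> (1/3)^n * dist x z"
          using Xd[of n x z] unfolding Xz real_norm_def by linarith
      qed
      show "summable (\<lambda>n. (1/3::real)^n * dist x z)"
        by (intro summable_mult2 summable_geometric) auto
    qed
    then have "convergent (\<lambda>n. X n x - X 0 x)"
      unfolding summable_iff_convergent sum_lessThan_telescope[of "\<lambda>n. X n x"] .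
    then show ?thesis by (simp add: X0)
  qed
  define Y where "Y x = lim (\<lambda>n. X n x)" for x
  have lim: "(\<lambda>n. X n x) \<longlonglongrightarrow> Y x" for x
    using conv unfolding Y_def by (simp add: convergent_LIMSEQ_iff)
  have Ytail: "((1/3)^m / 2)-lipschitz_on UNIV (\<lambda>x. Y x - X m x)" for m
  proof (rule lipschitz_onI)
    fix x y
    have "(\<lambda>k. \<bar>(X (m + k) x - X m x) - (X (m + k) y - X m y)\<bar>) \<longlonglongrightarrow> \<bar>(Y x - X m x) - (Y y - X m y)\<bar>"
      using LIMSEQ_ignore_initial_segment[OF lim, of m] by (intro tendsto_intros) (simp_all add: add.commute)
    then have "\<bar>(Y x - X m x) - (Y y - X m y)\<bar> \<le> (1/3)^m / 2 * dist x y"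
      by (rule LIMSEQ_le_const2) (use Xtail' in auto)
    then show "dist (Y x - X m x) (Y y - X m y) \<le> (1/3)^m / 2 * dist x y" by (simp add: dist_real_def)
  qed simp
  have "(1/2)-lipschitz_on UNIV Y" using Ytail[of 0] by (simp add: X0)
  from ptw[OF this] obtain B where B: "\<And>n. T n Y \<le> B" using T by blast
  have "2 ^ Suc n \<le> B" for n
  proof -
    have "T n (X (Suc n)) \<le> T n Y + T n (\<lambda>x. -1 * (Y x - X (Suc n) x))"
      using add[OF T, of n Y "\<lambda>x. -1 * (Y x - X (Suc n) x)"] by simp
    also have "T n (\<lambda>x. -1 * (Y x - X (Suc n) x)) = T n (\<lambda>x. Y x - X (Suc n) x)"
      using scale[OF T, of n "-1" "\<lambda>x. Y x - X (Suc n) x"] by simp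
    also have "\<dots> \<le> M (T n) * ((1/3)^Suc n / 2)"
      by (rule Mlip[OF T Ytail]) simp
    finally have "T n Y \<ge> (1/3)^Suc n * (3/4 * M (T n)) - M (T n) * ((1/3)^Suc n / 2)"
      using TX[of n] TV[of n] by linarith
    also have "(1/3)^Suc n * (3/4 * M (T n)) - M (T n) * ((1/3)^Suc n / 2) = (1/3)^Suc n * (M (T n) / 4)"
      by (simp add: algebra_simps)
    finally have "(1/3)^Suc n * (M (T n) / 4) \<le> B" using B[of n] by linarith
    moreover have "(1/3)^Suc n * (6 ^ Suc n) \<le> (1/3)^Suc n * (M (T n) / 4)"
      using M[of n] by (intro mult_left_mono) auto
    moreover have "(1/3)^Suc n * (6 ^ Suc n) = (2::real) ^ Suc n"
      by (subst power_mult_distrib[symmetric]) simp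
    ultimately show ?thesis by linarith
  qed
  moreover obtain n where "B < 2 ^ n" using real_arch_pow[of 2 B] by auto
  moreover have "(2::real)^n \<le> 2 ^ Suc n" by simp
  ultimately show False by (smt (verit))
qed

section \<open>Sawtooth functions and Lipschitz functions\<close>

text \<open>
  The distance of \<open>x\<close> to the multiples of \<open>r\<close>. Composing a function with it makes the values
  as small as desired while keeping, up to a constant factor, the length of the image of a small set.
\<close>

definition sawtooth :: "real \<Rightarrow> real \<Rightarrow> real" where
  "sawtooth r x = \<bar>x - r * of_int (round (x / r))\<bar>"

lemma sawtooth_nonneg: "0 \<le> sawtooth r x"
  by (simp add: sawtooth_def)

lemma sawtooth_minimal: "0 < r \<Longrightarrow> sawtooth r x \<le> \<bar>x - r * of_int m\<bar>"
proof -
  assume r: "0 < r"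
  have *: "\<bar>x - r * of_int k\<bar> = r * \<bar>x / r - of_int k\<bar>" for k :: int
  proof -
    have "x - r * of_int k = r * (x / r - of_int k)" using r by (simp add: right_diff_distrib)
    then show ?thesis using r by (simp only: abs_mult)
  qed
  show ?thesis
    unfolding sawtooth_def * using round_diff_minimal[of "x / r" m] r by simp
qed

lemma sawtooth_le: "0 < r \<Longrightarrow> sawtooth r x \<le> r"
proof -
  assume r: "0 < r"
  have "\<bar>x - r * of_int \<lfloor>x / r\<rfloor>\<bar> \<le> r"
  proof -
    have "of_int \<lfloor>x / r\<rfloor> \<le> x / r" "x / r \<le> of_int \<lfloor>x / r\<rfloor> + 1" by linarith+
    then have "of_int \<lfloor>x / r\<rfloor> * r \<le> x" "x \<le> (of_int \<lfloor>x / r\<rfloor> + 1) * r"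
      using r by (simp_all only: pos_le_divide_eq pos_divide_le_eq)
    then show ?thesis by (simp add: algebra_simps)
  qed
  then show ?thesis using sawtooth_minimal[OF r, of x "\<lfloor>x / r\<rfloor>"] by linarith
qed

lemma sawtooth_lipschitz: "0 < r \<Longrightarrow> 1-lipschitz_on UNIV (sawtooth r)"
proof (rule lipschitz_onI)
  assume r: "0 < r"
  have "sawtooth r x \<le> \<bar>x - y\<bar> + sawtooth r y" for x y
    using sawtooth_minimal[OF r, of x "round (y / r)"] unfolding sawtooth_def[of r y] by linarith
  from this[of _ _] show "dist (sawtooth r x) (sawtooth r y) \<le> 1 * dist x y" for x y
    by (smt (verit) dist_real_def)
qed simp

text \<open>
  A point of an interval of length \<open>r\<close> rounds to one of two consecutive multiples of \<open>r\<close> and lies on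
  one of two sides of it; so the set is covered by four isometric copies of its image.
\<close>

lemma measure_le_sawtooth:
  assumes r: "0 < r" and E: "compact E" and d: "\<And>x. x \<in> E \<Longrightarrow> u \<le> x \<and> x \<le> u + r"
  shows "measure lebesgue E \<le> 4 * measure lebesgue (sawtooth r ` E)"
proof -
  define k0 where "k0 = round (u / r)"
  define D where "D = sawtooth r ` E"
  have "compact D" unfolding D_def
    using E lipschitz_on_continuous_on[OF sawtooth_lipschitz[OF r]]
    by (intro compact_continuous_image) (auto intro: continuous_on_subset)
  then have Dm: "D \<in> lmeasurable" by (rule lmeasurable_compact)
  define P where "P k = (\<lambda>y. r * of_int k + y) ` D" for k :: int
  define N where "N k = (\<lambda>y. r * of_int k + y) ` uminus ` D" for k :: int
  have PN: "P k \<in> lmeasurable" "N k \<in> lmeasurable"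
    "measure lebesgue (P k) = measure lebesgue D" "measure lebesgue (N k) = measure lebesgue D" for k
  proof -
    have nm: "uminus ` D \<in> lmeasurable"
      using \<open>compact D\<close> by (intro lmeasurable_compact compact_negations)
    show "P k \<in> lmeasurable" "N k \<in> lmeasurable"
      unfolding P_def N_def using measurable_translation[OF Dm] measurable_translation[OF nm] by auto
    show "measure lebesgue (P k) = measure lebesgue D"
      unfolding P_def by (rule measure_translation)
    have "measure lebesgue (uminus ` D) = measure lebesgue D"
      using measure_lebesgue_affine[of "-1" 0 D] by simp
    then show "measure lebesgue (N k) = measure lebesgue D"
      unfolding N_def measure_translation by simp
  qed
  have sub: "E \<subseteq> (P k0 \<union> N k0) \<union> (P (k0+1) \<union> N (k0+1))"
  proof
    fix x assume x: "x \<in> E"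
    have "round (u / r) \<le> round (x / r)" "round (x / r) \<le> round (u / r + 1)"
      using d[OF x] r by (auto intro!: round_mono simp: field_simps)
    moreover have "round (u / r + 1) = round (u / r) + 1"
      unfolding round_def by linarith
    ultimately have k: "round (x / r) = k0 \<or> round (x / r) = k0 + 1" unfolding k0_def by linarith
    have s: "sawtooth r x \<in> D" using x by (simp add: D_def)
    have "x = r * of_int (round (x / r)) + sawtooth r x \<or> x = r * of_int (round (x / r)) + - sawtooth r x"
      unfolding sawtooth_def by linarith
    then have "x \<in> P (round (x / r)) \<or> x \<in> N (round (x / r))"
      unfolding P_def N_def using s by blast
    then show "x \<in> (P k0 \<union> N k0) \<union> (P (k0+1) \<union> N (k0+1))" using k by auto
  qed
  have "measure lebesgue E \<le> measure lebesgue ((P k0 \<union> N k0) \<union> (P (k0+1) \<union> N (k0+1)))"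
    using sub PN E by (intro measure_mono_fmeasurable fmeasurable.Un) (auto intro: fmeasurableD lmeasurable_compact)
  also have "\<dots> \<le> measure lebesgue (P k0 \<union> N k0) + measure lebesgue (P (k0+1) \<union> N (k0+1))"
    using PN by (intro measure_Un_le) (auto intro: fmeasurableD)
  also have "\<dots> \<le> (measure lebesgue (P k0) + measure lebesgue (N k0)) + (measure lebesgue (P (k0+1)) + measure lebesgue (N (k0+1)))"
    using PN by (intro add_mono measure_Un_le) (auto intro: fmeasurableD)
  also have "\<dots> = 4 * measure lebesgue D" using PN by simp
  finally show ?thesis by (simp add: D_def)
qed

lemma lipschitz_on_max:
  fixes f g :: "'a::metric_space \<Rightarrow> real"
  assumes "L-lipschitz_on S f" "L-lipschitz_on S g"
  shows "L-lipschitz_on S (\<lambda>x. max (f x) (g x))"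
proof (rule lipschitz_onI)
  fix x y assume "x \<in> S" "y \<in> S"
  then show "dist (max (f x) (g x)) (max (f y) (g y)) \<le> L * dist x y"
    using lipschitz_onD[OF assms(1), of x y] lipschitz_onD[OF assms(2), of x y]
    by (auto simp: dist_real_def max_def)
qed (rule lipschitz_on_nonneg[OF assms(1)])

lemma lipschitz_on_Max:
  fixes f :: "'i \<Rightarrow> 'a::metric_space \<Rightarrow> real"
  assumes "finite I" "I \<noteq> {}" "\<And>i. i \<in> I \<Longrightarrow> L-lipschitz_on S (f i)"
  shows "L-lipschitz_on S (\<lambda>x. Max ((\<lambda>i. f i x) ` I))"
  using assms
proof (induction rule: finite_ne_induct)
  case (insert i F)
  then have "(\<lambda>x. Max ((\<lambda>i. f i x) ` insert i F)) = (\<lambda>x. max (f i x) (Max ((\<lambda>i. f i x) ` F)))"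
    by auto
  then show ?case using insert by (auto intro: lipschitz_on_max)
qed simp

lemma lipschitz_on_dist: "1-lipschitz_on UNIV (\<lambda>x::'a::metric_space. dist x z)"
proof (rule lipschitz_onI)
  show "dist (dist x z) (dist y z) \<le> 1 * dist x y" for x y
    using dist_triangle[of x z y] dist_triangle[of y z x] dist_commute[of x y] by (simp add: dist_real_def)
qed simp

lemma lipschitz_on_infdist: "1-lipschitz_on UNIV (\<lambda>x::'a::metric_space. infdist x A)"
proof (rule lipschitz_onI)
  show "dist (infdist x A) (infdist y A) \<le> 1 * dist x y" for x y
    using infdist_triangle[of x A y] infdist_triangle[of y A x] by (simp add: dist_real_def dist_commute)
qed simp

section \<open>A Lipschitz function oscillating along finitely many arcs\<close>

text \<open>
  The oscillation of \<open>h \<circ> \<gamma>\<close> is measured on the pieces of an arbitrary cover of \<open>[s\<^sub>i, t\<^sub>i]\<close> by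
  intervals shorter than \<open>\<eta>\<close>; the same \<open>h\<close> serves all \<open>i\<close>.

  The arc \<open>C i = \<gamma> [s\<^sub>i, t\<^sub>i]\<close> is connected, so its image under \<open>H i = dist \<cdot> (\<gamma> s\<^sub>i)\<close> contains
  \<open>[0, dist (\<gamma> s\<^sub>i) (\<gamma> t\<^sub>i)]\<close>. Let \<open>K S\<close> consist of the points that lie on exactly the arcs with
  index in \<open>S\<close> and have distance at least \<open>r\<close> from the others. For small \<open>r\<close> these compact sets
  lose little of \<open>C i\<close>, and they are \<open>r\<close>-separated. On \<open>K S\<close> all arcs with index in \<open>S\<close> pass
  through the same points, so one index \<open>n S\<close>, maximising the length of \<open>H i (K S)\<close>, is good for
  all of them. As a sawtooth of \<open>H (n S)\<close> has values in \<open>[0, r]\<close>, the sawtooths on the different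
  \<open>K S\<close> are the restrictions of one Lipschitz function.
\<close>

lemma fine_oscillation:
  fixes \<gamma> :: "real \<Rightarrow> 'x::metric_space" and s t :: "'i \<Rightarrow> real"
  assumes I: "finite I" and st: "\<And>i. i \<in> I \<Longrightarrow> a \<le> s i \<and> s i \<le> t i \<and> t i \<le> b"
    and cont: "continuous_on {a..b} \<gamma>" and e: "0 < e"
  shows "\<exists>h \<eta>. 2-lipschitz_on UNIV h \<and> 0 < \<eta> \<and>
    (\<forall>i\<in>I. \<forall>N u v. (\<forall>k<N. a \<le> u k \<and> u k \<le> v k \<and> v k \<le> b \<and> v k - u k < \<eta>) \<longrightarrow>
        {s i..t i} \<subseteq> (\<Union>k<N::nat. {u k..v k}) \<longrightarrow>
      (\<exists>x y. (\<forall>k<N. x k \<in> {u k..v k} \<and> y k \<in> {u k..v k}) \<and>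
        dist (\<gamma> (s i)) (\<gamma> (t i)) - e \<le> 4 * (\<Sum>k<N. \<bar>h (\<gamma> (x k)) - h (\<gamma> (y k))\<bar>)))"
proof -
  define C where "C i = \<gamma> ` {s i..t i}" for i
  define H where "H i x = dist x (\<gamma> (s i))" for i x
  define P where "P r = {x. \<forall>j\<in>I. x \<in> C j \<or> r \<le> infdist x (C j)}" for r
  have Ccomp: "compact (C i)" and Cne: "C i \<noteq> {}" and Ccon: "connected (C i)" if "i \<in> I" for i
  proof -
    have c: "continuous_on {s i..t i} \<gamma>" using st[OF that] by (intro continuous_on_subset[OF cont]) auto
    show "compact (C i)" unfolding C_def by (intro compact_continuous_image c) auto
    show "connected (C i)" unfolding C_def by (intro connected_continuous_image c) auto
    show "C i \<noteq> {}" using st[OF that] by (simp add: C_def)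
  qed
  have Hlip: "1-lipschitz_on UNIV (H i)" for i unfolding H_def by (rule lipschitz_on_dist)
  have Hcont: "continuous_on A (H i)" for i A
    using lipschitz_on_continuous_on[OF Hlip] by (rule continuous_on_subset) auto
  have clP: "closed (P r)" for r
  proof -
    have "P r = (\<Inter>j\<in>I. C j \<union> {x. r \<le> infdist x (C j)})" by (auto simp: P_def)
    moreover have "closed {x. r \<le> infdist x (C j)}" for j
      by (intro closed_Collect_le continuous_intros)
    ultimately show ?thesis using Ccomp by (simp only:) (intro closed_INT ballI closed_Un; simp add: compact_imp_closed)
  qed
  have CP: "compact (C i \<inter> P r)" if "i \<in> I" for i r
    using Ccomp[OF that] clP by (rule compact_Int_closed)
  \<comment> \<open>Points of an arc have positive distance from the arcs that miss them, so \<open>C i \<inter> P r\<close> exhausts \<open>C i\<close>.\<close>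
  have ev: "\<forall>\<^sub>F m in sequentially. dist (\<gamma> (s i)) (\<gamma> (t i)) - e < measure lebesgue (H i ` (C i \<inter> P (1 / real (Suc m))))"
    if i: "i \<in> I" for i
  proof -
    define A where "A m = H i ` (C i \<inter> P (1 / real (Suc m)))" for m
    have Acomp: "compact (A m)" for m
      unfolding A_def by (intro compact_continuous_image Hcont CP[OF i])
    have "incseq A"
    proof (rule incseq_SucI)
      fix m
      have "1 / real (Suc (Suc m)) \<le> 1 / real (Suc m)" by (intro divide_left_mono) auto
      then have "P (1 / real (Suc m)) \<subseteq> P (1 / real (Suc (Suc m)))"
        unfolding P_def using order_trans[of "1 / real (Suc (Suc m))" "1 / real (Suc m)"] by blast
      then show "A m \<subseteq> A (Suc m)" by (auto simp: A_def)
    qed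
    have UA: "(\<Union>m. A m) = H i ` C i"
    proof -
      have "\<exists>m. x \<in> P (1 / real (Suc m))" if x: "x \<in> C i" for x
      proof -
        define J where "J = {j\<in>I. x \<notin> C j}"
        have "\<forall>\<^sub>F m in sequentially. \<forall>j\<in>J. 1 / real (Suc m) < infdist x (C j)"
        proof (rule eventually_ball_finite)
          show "finite J" using I by (simp add: J_def)
          show "\<forall>j\<in>J. \<forall>\<^sub>F m in sequentially. 1 / real (Suc m) < infdist x (C j)"
          proof
            fix j assume j: "j \<in> J"
            then have "j \<in> I" "x \<notin> C j" by (auto simp: J_def)
            then have "0 < infdist x (C j)"
              using in_closed_iff_infdist_zero[OF compact_imp_closed[OF Ccomp[OF \<open>j \<in> I\<close>]] Cne[OF \<open>j \<in> I\<close>]]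
                infdist_nonneg[of x "C j"] by (metis order_le_less)
            then show "\<forall>\<^sub>F m in sequentially. 1 / real (Suc m) < infdist x (C j)"
              using LIMSEQ_Suc[OF lim_1_over_n] by (rule order_tendstoD(2)[rotated])
          qed
        qed
        then obtain m where "\<forall>j\<in>J. 1 / real (Suc m) < infdist x (C j)"
          unfolding eventually_sequentially by blast
        then have "x \<in> P (1 / real (Suc m))" unfolding P_def J_def using less_imp_le by blast
        then show ?thesis ..
      qed
      then have "C i \<subseteq> (\<Union>m. C i \<inter> P (1 / real (Suc m)))" by blast
      then have "(\<Union>m. C i \<inter> P (1 / real (Suc m))) = C i" by blast
      then show ?thesis unfolding A_def image_UN[symmetric] by (rule arg_cong)
    qed
    have Hmeas: "H i ` C i \<in> lmeasurable"
      by (intro lmeasurable_compact compact_continuous_image Hcont Ccomp[OF i])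
    have "(\<lambda>m. measure lebesgue (A m)) \<longlonglongrightarrow> measure lebesgue (\<Union>m. A m)"
    proof (rule Lim_measure_incseq[OF _ \<open>incseq A\<close>])
      show "range A \<subseteq> sets lebesgue" using Acomp by (auto intro: fmeasurableD lmeasurable_compact)
      show "emeasure lebesgue (\<Union>m. A m) \<noteq> \<infinity>" 
        unfolding UA infinity_ennreal_def by (rule fmeasurableD2[OF Hmeas])
    qed
    moreover have "dist (\<gamma> (s i)) (\<gamma> (t i)) - e < measure lebesgue (\<Union>m. A m)"
    proof -
      have cc: "connected (H i ` C i)" by (intro connected_continuous_image Hcont Ccon[OF i])
      have "0 \<in> H i ` C i" "dist (\<gamma> (s i)) (\<gamma> (t i)) \<in> H i ` C i"
        using st[OF i] by (force simp: H_def C_def image_iff, force simp: H_def C_def image_iff dist_commute)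
      then have "{0..dist (\<gamma> (s i)) (\<gamma> (t i))} \<subseteq> H i ` C i"
        by (rule connected_contains_Icc[OF cc])
      then have "measure lebesgue {0..dist (\<gamma> (s i)) (\<gamma> (t i))} \<le> measure lebesgue (H i ` C i)"
        by (intro measure_mono_fmeasurable Hmeas) auto
      then show ?thesis using e by (simp add: UA)
    qed
    ultimately show ?thesis unfolding A_def by (intro order_tendstoD(1))
  qed
  have "\<forall>\<^sub>F m in sequentially. \<forall>i\<in>I. dist (\<gamma> (s i)) (\<gamma> (t i)) - e < measure lebesgue (H i ` (C i \<inter> P (1 / real (Suc m))))"
    using I ev by (intro eventually_ball_finite) auto
  then obtain m where m: "\<forall>i\<in>I. dist (\<gamma> (s i)) (\<gamma> (t i)) - e < measure lebesgue (H i ` (C i \<inter> P (1 / real (Suc m))))"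
    unfolding eventually_sequentially by blast
  define r where "r = 1 / real (Suc m)"
  have r: "0 < r" by (simp add: r_def)
  define K where "K S = {x \<in> P r. {j\<in>I. x \<in> C j} = S}" for S
  define \<S> where "\<S> = {S. S \<subseteq> I \<and> S \<noteq> {} \<and> K S \<noteq> {}}"
  have fS: "finite \<S>" by (rule finite_subset[of _ "Pow I"]) (use I in \<open>auto simp: \<S>_def\<close>)
  have Kcomp: "compact (K S)" if S: "S \<in> \<S>" for S
  proof -
    from S obtain i where i: "i \<in> S" "i \<in> I" by (auto simp: \<S>_def)
    have "K S = C i \<inter> ((\<Inter>j\<in>S. C j) \<inter> (\<Inter>j\<in>I - S. {x. r \<le> infdist x (C j)}))" (is "_ = _ \<inter> ?R")
    proof
      show "K S \<subseteq> C i \<inter> ?R" using i by (auto simp: K_def P_def)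
      show "C i \<inter> ?R \<subseteq> K S"
      proof
        fix x assume x: "x \<in> C i \<inter> ?R"
        have "x \<notin> C j" if j: "j \<in> I - S" for j
        proof
          assume "x \<in> C j"
          then have "infdist x (C j) = 0" by simp
          then show False using x j r by force
        qed
        then have "{j\<in>I. x \<in> C j} = S" using x S by (auto simp: \<S>_def)
        moreover have "x \<in> P r" using x by (auto simp: P_def)
        ultimately show "x \<in> K S" by (simp add: K_def)
      qed
    qed
    moreover have "closed {x. r \<le> infdist x (C j)}" for j
      by (intro closed_Collect_le continuous_intros)
    moreover have "closed (C j)" if "j \<in> S" for j using that S Ccomp by (auto simp: \<S>_def intro: compact_imp_closed)
    ultimately show ?thesis using Ccomp[OF i(2)]
      by (simp only:) (intro compact_Int_closed closed_Int closed_INT; simp)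
  qed
  have sep: "r \<le> dist x y" if "x \<in> K S" "y \<in> K S'" "S \<noteq> S'" for x y S S'
  proof -
    have *: "r \<le> dist x y" if "x \<in> K S" "y \<in> K S'" "i \<in> S" "i \<notin> S'" for x y S S' i
    proof -
      have "i \<in> I" "x \<in> C i" "y \<in> P r" "y \<notin> C i" using that by (auto simp: K_def)
      then have "r \<le> infdist y (C i)" by (auto simp: P_def)
      also have "\<dots> \<le> dist y x" using \<open>x \<in> C i\<close> by (rule infdist_le)
      finally show ?thesis by (simp add: dist_commute)
    qed
    from that(3) obtain i where "i \<in> S \<and> i \<notin> S' \<or> i \<in> S' \<and> i \<notin> S" by auto
    then show ?thesis using *[of x S y S' i] *[of y S' x S i] that by (auto simp: dist_commute)
  qed
  have "\<exists>n\<in>S. \<forall>i\<in>S. measure lebesgue (H i ` K S) \<le> measure lebesgue (H n ` K S)" if "S \<in> \<S>" for S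
  proof -
    have "finite S" "S \<noteq> {}" using that I by (auto simp: \<S>_def intro: finite_subset)
    then obtain k where "k \<in> S" "Max ((\<lambda>i. measure lebesgue (H i ` K S)) ` S) = measure lebesgue (H k ` K S)"
      using Max_in[of "(\<lambda>i. measure lebesgue (H i ` K S)) ` S"] by blast
    with \<open>finite S\<close> show ?thesis by (metis Max_ge finite_imageI imageI)
  qed
  then obtain n where n: "\<And>S i. S \<in> \<S> \<Longrightarrow> i \<in> S \<Longrightarrow> measure lebesgue (H i ` K S) \<le> measure lebesgue (H (n S) ` K S)"
    by metis
  \<comment> \<open>On \<open>K S\<close> the function \<open>Z S\<close> is the sawtooth itself; on every other \<open>K S'\<close> it is nonpositive by separation.\<close>
  define Z where "Z S x = sawtooth r (H (n S) x) - infdist x (K S)" for S x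
  define h where "h x = Max (insert 0 ((\<lambda>S. Z S x) ` \<S>))" for x
  have sawH: "1-lipschitz_on UNIV (\<lambda>x. sawtooth r (H (n S) x))" for S
    using lipschitz_on_compose2[OF Hlip[of "n S"] lipschitz_on_subset[OF sawtooth_lipschitz[OF r]]] by simp
  have Zlip: "2-lipschitz_on UNIV (Z S)" for S
    unfolding Z_def using lipschitz_on_diff[OF sawH lipschitz_on_infdist] by simp
  have hlip: "2-lipschitz_on UNIV h"
  proof (cases "\<S> = {}")
    case True
    then show ?thesis unfolding h_def by (simp add: lipschitz_on_def)
  next
    case False
    have "h = (\<lambda>x. max 0 (Max ((\<lambda>S. Z S x) ` \<S>)))"
      unfolding h_def using fS False by auto
    moreover have "2-lipschitz_on UNIV (\<lambda>x::'x. 0::real)" by (simp add: lipschitz_on_def)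
    ultimately show ?thesis using lipschitz_on_Max[OF fS False Zlip] by (simp add: lipschitz_on_max)
  qed
  have hK: "h x = sawtooth r (H (n S) x)" if S: "S \<in> \<S>" and x: "x \<in> K S" for S x
  proof -
    have ZS: "Z S x = sawtooth r (H (n S) x)" using x by (simp add: Z_def)
    moreover have Zle: "Z S' x \<le> 0" if S': "S' \<in> \<S>" "S' \<noteq> S" for S'
    proof -
      have "r \<le> infdist x (K S')"
        using S' sep[OF x _ S'(2)[symmetric]] by (auto simp: infdist_def \<S>_def intro!: cINF_greatest)
      then show ?thesis using sawtooth_le[OF r, of "H (n S') x"] by (simp add: Z_def)
    qed
    ultimately have "z \<le> sawtooth r (H (n S) x)" if "z \<in> insert 0 ((\<lambda>S. Z S x) ` \<S>)" for z
    proof (cases "z = 0")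
      case True then show ?thesis by (simp add: sawtooth_nonneg)
    next
      case False
      then obtain S' where S': "S' \<in> \<S>" "z = Z S' x" using \<open>z \<in> insert 0 ((\<lambda>S. Z S x) ` \<S>)\<close> by blast
      then show ?thesis
        using ZS Zle[of S'] sawtooth_nonneg[of r "H (n S) x"] by (cases "S' = S") auto
    qed
    moreover have "sawtooth r (H (n S) x) \<in> insert 0 ((\<lambda>S. Z S x) ` \<S>)"
      using S ZS by (intro insertI2 image_eqI[of _ _ S]) auto
    ultimately show ?thesis unfolding h_def using fS by (intro Max_eqI) auto
  qed
  have "uniformly_continuous_on {a..b} \<gamma>" using cont by (intro compact_uniformly_continuous) auto
  then obtain \<eta> where \<eta>: "0 < \<eta>"
    and small: "\<And>x y. x \<in> {a..b} \<Longrightarrow> y \<in> {a..b} \<Longrightarrow> dist y x < \<eta> \<Longrightarrow> dist (\<gamma> y) (\<gamma> x) < r"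
    using r unfolding uniformly_continuous_on_def by blast
  have "\<exists>x y. (\<forall>k<N. x k \<in> {u k..v k} \<and> y k \<in> {u k..v k}) \<and>
        dist (\<gamma> (s i)) (\<gamma> (t i)) - e \<le> 4 * (\<Sum>k<N. \<bar>h (\<gamma> (x k)) - h (\<gamma> (y k))\<bar>)"
    if i: "i \<in> I" and uv: "\<forall>k<N. a \<le> u k \<and> u k \<le> v k \<and> v k \<le> b \<and> v k - u k < \<eta>"
      and cov: "{s i..t i} \<subseteq> (\<Union>k<N. {u k..v k})" for i u v and N :: nat
  proof -
    define Q where "Q k = \<gamma> ` {u k..v k}" for k
    have Qcomp: "compact (Q k)" if "k < N" for k unfolding Q_def
      using uv that by (intro compact_continuous_image continuous_on_subset[OF cont]) auto
    have hcont: "continuous_on A h" for A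
      using lipschitz_on_continuous_on[OF hlip] by (rule continuous_on_subset) auto
    have Qdiam: "dist p q < r" if k: "k < N" and pq: "p \<in> Q k" "q \<in> Q k" for k p q
    proof -
      from pq obtain p' q' where "p' \<in> {u k..v k}" "q' \<in> {u k..v k}" "p = \<gamma> p'" "q = \<gamma> q'"
        by (auto simp: Q_def)
      moreover have "a \<le> u k" "v k \<le> b" "v k - u k < \<eta>" using uv k by auto
      ultimately show ?thesis using small[of q' p'] by (auto simp: dist_real_def)
    qed
    have "\<exists>x y. x \<in> {u k..v k} \<and> y \<in> {u k..v k} \<and> h ` Q k \<subseteq> {h (\<gamma> x)..h (\<gamma> y)}" if k: "k < N" for k
    proof -
      have ne: "Q k \<noteq> {}" using uv k by (auto simp: Q_def)
      obtain p q where "p \<in> Q k" "q \<in> Q k" and pq: "\<And>z. z \<in> Q k \<Longrightarrow> h p \<le> h z \<and> h z \<le> h q"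
        using continuous_attains_inf[OF Qcomp[OF k] ne hcont] continuous_attains_sup[OF Qcomp[OF k] ne hcont]
        by metis
      moreover then obtain x y where "x \<in> {u k..v k}" "y \<in> {u k..v k}" "p = \<gamma> x" "q = \<gamma> y"
        by (auto simp: Q_def)
      ultimately show ?thesis by (intro exI[of _ x] exI[of _ y]) auto
    qed
    then obtain x y where xy: "\<And>k. k < N \<Longrightarrow> x k \<in> {u k..v k} \<and> y k \<in> {u k..v k} \<and> h ` Q k \<subseteq> {h (\<gamma> (x k))..h (\<gamma> (y k))}"
      by metis
    define l where "l k = \<bar>h (\<gamma> (x k)) - h (\<gamma> (y k))\<bar>" for k
    \<comment> \<open>The pieces that meet \<open>K S\<close>. Fineness of the cover makes them disjoint for different \<open>S\<close>.\<close>
    define A where "A S = {k. k < N \<and> Q k \<inter> K S \<noteq> {}}" for S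
    have fA: "finite (A S)" for S by (simp add: A_def)
    have piece: "measure lebesgue (H (n S) ` (K S \<inter> Q k)) \<le> 4 * l k" if S: "S \<in> \<S>" and k: "k \<in> A S" for S k
    proof -
      have kN: "k < N" using k by (simp add: A_def)
      define E where "E = H (n S) ` (K S \<inter> Q k)"
      have Ecomp: "compact E" unfolding E_def
        using Kcomp[OF S] Qcomp[OF kN] by (intro compact_continuous_image Hcont compact_Int)
      have Ene: "E \<noteq> {}" using k by (auto simp: A_def E_def)
      obtain w where w: "w \<in> E" "\<And>z. z \<in> E \<Longrightarrow> w \<le> z"
        using compact_attains_inf[OF Ecomp Ene] by blast
      have "z \<le> w + r" if z: "z \<in> E" for z
      proof -
        from z w(1) obtain p q where "p \<in> Q k" "q \<in> Q k" "z = H (n S) p" "w = H (n S) q" by (auto simp: E_def)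
        then show ?thesis using lipschitz_onD[OF Hlip, of p q "n S"] Qdiam[OF kN, of p q]
          by (simp add: dist_real_def)
      qed
      then have "measure lebesgue E \<le> 4 * measure lebesgue (sawtooth r ` E)"
        using w(2) by (intro measure_le_sawtooth[OF r Ecomp, of w]) auto
      also have "sawtooth r ` E \<subseteq> h ` Q k" using hK[OF S] by (force simp: E_def image_iff)
      then have "sawtooth r ` E \<subseteq> {h (\<gamma> (x k))..h (\<gamma> (y k))}" using xy[OF kN] by blast
      then have "measure lebesgue (sawtooth r ` E) \<le> measure lebesgue {h (\<gamma> (x k))..h (\<gamma> (y k))}"
        using Ecomp lipschitz_on_continuous_on[OF sawtooth_lipschitz[OF r]]
        by (intro measure_mono_fmeasurable fmeasurableD lmeasurable_compact compact_continuous_image)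
          (auto intro: continuous_on_subset)
      also have "\<dots> \<le> l k" by (auto simp: l_def)
      finally show ?thesis by (simp add: E_def)
    qed
    have KS: "measure lebesgue (H (n S) ` K S) \<le> 4 * (\<Sum>k\<in>A S. l k)" if S: "S \<in> \<S>" and iS: "i \<in> S" for S
    proof -
      have "H (n S) ` K S \<subseteq> (\<Union>k\<in>A S. H (n S) ` (K S \<inter> Q k))"
      proof -
        have "\<exists>k\<in>A S. p \<in> Q k" if p: "p \<in> K S" for p
        proof -
          have "p \<in> C i" using p iS by (auto simp: K_def)
          then obtain \<tau> where \<tau>: "\<tau> \<in> {s i..t i}" "p = \<gamma> \<tau>" by (auto simp: C_def)
          then obtain k where "k < N" "\<tau> \<in> {u k..v k}" using cov by blast
          then have "p \<in> Q k" using \<tau>(2) by (simp add: Q_def)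
          then show ?thesis using p \<open>k < N\<close> unfolding A_def by blast
        qed
        then show ?thesis by blast
      qed
      moreover have pm: "H (n S) ` (K S \<inter> Q k) \<in> lmeasurable" if "k \<in> A S" for k
        using that Kcomp[OF S] Qcomp[of k] by (intro lmeasurable_compact compact_continuous_image Hcont compact_Int) (auto simp: A_def)
      moreover have "H (n S) ` K S \<in> lmeasurable"
        using Kcomp[OF S] by (intro lmeasurable_compact compact_continuous_image Hcont)
      ultimately have "measure lebesgue (H (n S) ` K S) \<le> measure lebesgue (\<Union>k\<in>A S. H (n S) ` (K S \<inter> Q k))"
        using fA by (intro measure_mono_fmeasurable fmeasurable.finite_UN) (auto intro: fmeasurableD)
      also have "\<dots> \<le> (\<Sum>k\<in>A S. measure lebesgue (H (n S) ` (K S \<inter> Q k)))"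
        using fA pm by (intro measure_UNION_le) (auto intro: fmeasurableD)
      also have "\<dots> \<le> (\<Sum>k\<in>A S. 4 * l k)" using piece[OF S] by (rule sum_mono)
      finally show ?thesis by (simp add: sum_distrib_left)
    qed
    define \<T> where "\<T> = {S\<in>\<S>. i \<in> S}"
    have fT: "finite \<T>" using fS by (simp add: \<T>_def)
    have Hm: "H i ` K S \<in> lmeasurable" if "S \<in> \<T>" for S
      using that Kcomp[of S] by (intro lmeasurable_compact compact_continuous_image Hcont) (auto simp: \<T>_def)
    have "dist (\<gamma> (s i)) (\<gamma> (t i)) - e \<le> measure lebesgue (H i ` (C i \<inter> P r))"
      using m i by (force simp: r_def)
    also have "\<dots> \<le> measure lebesgue (\<Union>S\<in>\<T>. H i ` K S)"
    proof (rule measure_mono_fmeasurable)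
      show "H i ` (C i \<inter> P r) \<subseteq> (\<Union>S\<in>\<T>. H i ` K S)"
      proof clarify
        fix p assume p: "p \<in> C i" "p \<in> P r"
        define S where "S = {j\<in>I. p \<in> C j}"
        have "p \<in> K S" using p(2) by (simp add: K_def S_def)
        moreover have "i \<in> S" "S \<subseteq> I" using p(1) i by (auto simp: S_def)
        ultimately have "S \<in> \<T>" by (auto simp: \<T>_def \<S>_def)
        then show "H i p \<in> (\<Union>S\<in>\<T>. H i ` K S)" using \<open>p \<in> K S\<close> by blast
      qed
      show "H i ` (C i \<inter> P r) \<in> sets lebesgue"
        by (intro fmeasurableD lmeasurable_compact compact_continuous_image Hcont CP[OF i])
      show "(\<Union>S\<in>\<T>. H i ` K S) \<in> lmeasurable" using fT Hm by (intro fmeasurable.finite_UN) auto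
    qed
    also have "\<dots> \<le> (\<Sum>S\<in>\<T>. measure lebesgue (H i ` K S))"
      using fT Hm by (intro measure_UNION_le) (auto intro: fmeasurableD)
    also have "\<dots> \<le> (\<Sum>S\<in>\<T>. 4 * (\<Sum>k\<in>A S. l k))"
    proof (rule sum_mono)
      fix S assume "S \<in> \<T>"
      then have "S \<in> \<S>" "i \<in> S" by (auto simp: \<T>_def)
      from n[OF this] KS[OF this]
      show "measure lebesgue (H i ` K S) \<le> 4 * (\<Sum>k\<in>A S. l k)" by (rule order_trans)
    qed
    also have "\<dots> = 4 * (\<Sum>k\<in>(\<Union>S\<in>\<T>. A S). l k)"
    proof -
      have "A S \<inter> A S' = {}" if "S \<noteq> S'" for S S'
      proof (rule ccontr)
        assume "A S \<inter> A S' \<noteq> {}"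
        then obtain k p q where "k < N" "p \<in> Q k" "p \<in> K S" "q \<in> Q k" "q \<in> K S'" by (auto simp: A_def)
        then show False using sep[of p S q S'] Qdiam[of k p q] that by auto
      qed
      then have "(\<Sum>k\<in>(\<Union>S\<in>\<T>. A S). l k) = (\<Sum>S\<in>\<T>. \<Sum>k\<in>A S. l k)"
        using fT fA by (intro sum.UNION_disjoint) auto
      then show ?thesis by (simp add: sum_distrib_left)
    qed
    also have "\<dots> \<le> 4 * (\<Sum>k<N. l k)"
      by (intro mult_left_mono sum_mono2) (auto simp: A_def l_def)
    finally have "dist (\<gamma> (s i)) (\<gamma> (t i)) - e \<le> 4 * (\<Sum>k<N. l k)" .
    then show ?thesis using xy unfolding l_def by (intro exI[of _ x] exI[of _ y]) simp
  qed
  then show ?thesis using hlip \<eta> by blast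
qed

section \<open>Absolutely continuous curves\<close>

lemma Lp_integrable:
  assumes g: "g \<in> Lp p a b" and p: "1 \<le> p"
  shows "integrable (lebesgue_on {a..b}) g"
proof -
  have fin: "finite_measure (lebesgue_on {a..b})"
    by (intro finite_measure_lebesgue_on) auto
  have gm: "g \<in> borel_measurable (lebesgue_on {a..b})" using g by (simp add: Lp_def)
  show ?thesis
  proof (cases "p = \<infinity>")
    case True
    then obtain K where "AE t in lebesgue_on {a..b}. \<bar>g t\<bar> \<le> K" using g by (auto simp: Lp_def)
    then show ?thesis using fin gm by (intro finite_measure.integrable_const_bound[of _ _ K]) auto
  next
    case False
    define P where "P = enn2real p"
    have P: "1 \<le> P" unfolding P_def
      using p False enn2real_mono[of 1 p] by (simp add: less_top)
    have int: "integrable (lebesgue_on {a..b}) (\<lambda>t. 1 + \<bar>g t\<bar> powr P)"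
      using g False finite_measure.integrable_const[OF fin] by (auto simp: Lp_def P_def)
    show ?thesis
    proof (rule Bochner_Integration.integrable_bound[OF int gm])
      have "\<bar>g t\<bar> \<le> 1 + \<bar>g t\<bar> powr P" for t
      proof (cases "\<bar>g t\<bar> \<le> 1")
        case True then show ?thesis using powr_ge_zero[of "\<bar>g t\<bar>" P] by linarith
      next
        case False
        then have "\<bar>g t\<bar> powr 1 \<le> \<bar>g t\<bar> powr P" using P by (intro powr_mono) auto
        then show ?thesis using False by simp
      qed
      then show "AE t in lebesgue_on {a..b}. norm (g t) \<le> norm (1 + \<bar>g t\<bar> powr P)"
        by (intro AE_I2) (smt (verit) powr_ge_zero real_norm_def)
    qed
  qed
qed

lemma set_integrable_lebesgue_subinterval:
  fixes g :: "real \<Rightarrow> real"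
  assumes "integrable (lebesgue_on {a..b}) g" "a \<le> u" "v \<le> b"
  shows "set_integrable lebesgue {u..v} g"
proof -
  have "set_integrable lebesgue {a..b} g"
    using assms(1) by (simp add: set_integrable_def integrable_restrict_space)
  then show ?thesis by (rule set_integrable_subset) (use assms in auto)
qed

lemma set_integral_eq_diff:
  fixes g :: "real \<Rightarrow> real"
  assumes g: "integrable (lebesgue_on {a..b}) g" and "a \<le> x" "x \<le> y" "y \<le> b"
  shows "(LINT \<tau>:{x..y}|lebesgue. g \<tau>) = integral {a..y} g - integral {a..x} g"
proof -
  have hk: "g integrable_on {a..b}"
    by (rule set_lebesgue_integral_eq_integral(1)[OF set_integrable_lebesgue_subinterval[OF g]]) auto
  have "(LINT \<tau>:{x..y}|lebesgue. g \<tau>) = integral {x..y} g"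
    using set_integrable_lebesgue_subinterval[OF g, of x y] assms by (intro set_lebesgue_integral_eq_integral(2)) auto
  moreover have "integral {a..x} g + integral {x..y} g = integral {a..y} g"
    using assms by (intro Henstock_Kurzweil_Integration.integral_combine integrable_subinterval_real[OF hk]) auto
  ultimately show ?thesis by simp
qed

lemma AC_real_increment:
  fixes f :: "real \<Rightarrow> real"
  assumes g: "integrable (lebesgue_on {a..b}) g" "\<And>t. t \<in> {a..b} \<Longrightarrow> 0 \<le> g t"
    and f: "\<And>x y. a \<le> x \<Longrightarrow> x \<le> y \<Longrightarrow> y \<le> b \<Longrightarrow> dist (f x) (f y) \<le> (LINT \<tau>:{x..y}|lebesgue. g \<tau>)"
    and uv: "a \<le> u" "v \<le> b" and xy: "x \<in> {u..v}" "y \<in> {u..v}"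
  shows "\<bar>f x - f y\<bar> \<le> (LINT \<tau>:{u..v}|lebesgue. g \<tau>)"
proof -
  have *: "dist (f x) (f y) \<le> (LINT \<tau>:{u..v}|lebesgue. g \<tau>)" if "x \<in> {u..v}" "y \<in> {u..v}" "x \<le> y" for x y
  proof -
    have "dist (f x) (f y) \<le> (LINT \<tau>:{x..y}|lebesgue. g \<tau>)" using that uv by (intro f) auto
    also have "\<dots> \<le> (LINT \<tau>:{u..v}|lebesgue. g \<tau>)"
      unfolding set_lebesgue_integral_def
      using set_integrable_lebesgue_subinterval[OF g(1), of x y] set_integrable_lebesgue_subinterval[OF g(1) uv] that uv g(2)
      by (intro integral_mono) (auto simp: set_integrable_def indicator_def)
    finally show ?thesis .
  qed
  show ?thesis using *[of x y] *[of y x] xy by (cases "x \<le> y") (auto simp: dist_real_def abs_minus_commute)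
qed

lemma AC_compose_lipschitz:
  assumes \<gamma>: "\<gamma> \<in> AC p a b" and h: "L-lipschitz_on UNIV h"
  shows "h \<circ> \<gamma> \<in> AC p a b"
proof -
  from \<gamma> obtain g where g: "g \<in> Lp p a b" "\<And>t. t \<in> {a..b} \<Longrightarrow> 0 \<le> g t"
    and gb: "\<And>x y. a \<le> x \<Longrightarrow> x \<le> y \<Longrightarrow> y \<le> b \<Longrightarrow> dist (\<gamma> x) (\<gamma> y) \<le> (LINT \<tau>:{x..y}|lebesgue. g \<tau>)"
    unfolding AC_def by blast
  have L: "0 \<le> L" by (rule lipschitz_on_nonneg[OF h])
  have gm: "g \<in> borel_measurable (lebesgue_on {a..b})" using g by (simp add: Lp_def)
  have "(\<lambda>t. L * g t) \<in> Lp p a b"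
  proof (cases "p = \<infinity>")
    case True
    then obtain K where "AE t in lebesgue_on {a..b}. \<bar>g t\<bar> \<le> K" using g by (auto simp: Lp_def)
    then have "AE t in lebesgue_on {a..b}. \<bar>L * g t\<bar> \<le> L * K"
      by eventually_elim (use L in \<open>simp add: abs_mult mult_left_mono\<close>)
    then show ?thesis using True gm by (auto simp: Lp_def)
  next
    case False
    have "(\<lambda>t. \<bar>L * g t\<bar> powr enn2real p) = (\<lambda>t. L powr enn2real p * \<bar>g t\<bar> powr enn2real p)"
      using L by (simp add: abs_mult powr_mult)
    then show ?thesis using g gm False by (auto simp: Lp_def)
  qed
  moreover have "dist ((h \<circ> \<gamma>) x) ((h \<circ> \<gamma>) y) \<le> (LINT \<tau>:{x..y}|lebesgue. L * g \<tau>)"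
    if "a \<le> x" "x \<le> y" "y \<le> b" for x y
  proof -
    have "dist ((h \<circ> \<gamma>) x) ((h \<circ> \<gamma>) y) \<le> L * dist (\<gamma> x) (\<gamma> y)" using lipschitz_onD[OF h] by simp
    also have "\<dots> \<le> L * (LINT \<tau>:{x..y}|lebesgue. g \<tau>)" using gb[OF that] L by (rule mult_left_mono)
    finally show ?thesis by simp
  qed
  ultimately show ?thesis unfolding AC_def using g(2) L by (auto intro!: bexI[of _ "\<lambda>t. L * g t"])
qed

text \<open>
  Taking \<open>z = \<gamma> t\<close> turns the bound on \<open>dist (\<gamma> \<cdot>) z\<close> into a bound on \<open>dist (\<gamma> x) (\<gamma> t)\<close> itself,
  so continuity at \<open>t\<close> follows from that of the indefinite integral.
\<close>

lemma continuous_on_if_dominated_by_integral: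
  fixes \<gamma> :: "real \<Rightarrow> 'x::metric_space"
  assumes L: "\<And>z. \<exists>g. integrable (lebesgue_on {a..b}) g \<and> (\<forall>t\<in>{a..b}. 0 \<le> g t) \<and>
    (\<forall>x y. a \<le> x \<and> x \<le> y \<and> y \<le> b \<longrightarrow> dist (dist (\<gamma> x) z) (dist (\<gamma> y) z) \<le> (LINT \<tau>:{x..y}|lebesgue. g \<tau>))"
  shows "continuous_on {a..b} \<gamma>"
  unfolding continuous_on_def
proof
  fix t assume "t \<in> {a..b}"
  then have t: "a \<le> t" "t \<le> b" by auto
  from L[of "\<gamma> t"] obtain g where g: "integrable (lebesgue_on {a..b}) g" "\<And>t. t \<in> {a..b} \<Longrightarrow> 0 \<le> g t"
    and gb: "\<And>x y. a \<le> x \<Longrightarrow> x \<le> y \<Longrightarrow> y \<le> b \<Longrightarrow> dist (dist (\<gamma> x) (\<gamma> t)) (dist (\<gamma> y) (\<gamma> t)) \<le> (LINT \<tau>:{x..y}|lebesgue. g \<tau>)"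
    by blast
  define F where "F x = integral {a..x} g" for x
  have hk: "g integrable_on {a..b}"
    by (rule set_lebesgue_integral_eq_integral(1)[OF set_integrable_lebesgue_subinterval[OF g(1)]]) auto
  have Fcont: "continuous_on {a..b} F"
    unfolding F_def by (rule indefinite_integral_continuous_1[OF hk])
  have diff: "(LINT \<tau>:{x..y}|lebesgue. g \<tau>) = F y - F x" if "a \<le> x" "x \<le> y" "y \<le> b" for x y
    unfolding F_def by (rule set_integral_eq_diff[OF g(1) that])
  have le: "dist (\<gamma> x) (\<gamma> t) \<le> \<bar>F x - F t\<bar>" if x: "x \<in> {a..b}" for x
    using gb[of x t] gb[of t x] diff[of x t] diff[of t x] x t by (cases "x \<le> t") auto
  have "(F \<longlongrightarrow> F t) (at t within {a..b})" using Fcont t by (auto simp: continuous_on_def)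
  then have "((\<lambda>x. \<bar>F x - F t\<bar>) \<longlongrightarrow> 0) (at t within {a..b})"
    by (intro tendsto_rabs_zero LIM_zero)
  then have "((\<lambda>x. dist (\<gamma> x) (\<gamma> t)) \<longlongrightarrow> 0) (at t within {a..b})"
    by (rule Lim_null_comparison[rotated]) (use le in \<open>simp add: eventually_at_filter\<close>)
  then show "(\<gamma> \<longlongrightarrow> \<gamma> t) (at t within {a..b})" by (subst tendsto_dist_iff)
qed

section \<open>Difference quotients over uniform partitions\<close>

text \<open>
  A crude form of Young's inequality. It replaces Hoelder's inequality below, and keeps \<open>p = 1\<close> from being a special case.
\<close>

lemma powr_mult_le_sum_powr:
  fixes u w :: real
  assumes "1 \<le> P" "0 \<le> u" "0 \<le> w"
  shows "u powr (P - 1) * w \<le> u powr P + w powr P"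
proof (cases "w \<le> u")
  case True
  then have "u powr (P - 1) * w \<le> u powr (P - 1) * u" by (intro mult_left_mono) auto
  also have "\<dots> = u powr P" using powr_mult_base[of u "P - 1"] assms by (simp add: mult.commute)
  finally show ?thesis using powr_ge_zero[of w P] by linarith
next
  case False
  then have "u powr (P - 1) * w \<le> w powr (P - 1) * w"
    using assms by (intro mult_right_mono powr_mono2) auto
  also have "\<dots> = w powr P" using powr_mult_base[of w "P - 1"] assms by (simp add: mult.commute)
  finally show ?thesis using powr_ge_zero[of u P] by linarith
qed

lemma sum_div_mod:
  fixes F :: "nat \<Rightarrow> nat \<Rightarrow> 'a::comm_monoid_add"
  assumes "0 < N"
  shows "(\<Sum>j<n * N. F (j div N) (j mod N)) = (\<Sum>i<n. \<Sum>k<N. F i k)"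
proof -
  have "(\<Sum>j<n * N. F (j div N) (j mod N)) = (\<Sum>i<n. \<Sum>j=i*N..<i*N+N. F (j div N) (j mod N))"
    by (rule sum.nat_group[symmetric])
  also have "\<dots> = (\<Sum>i<n. \<Sum>k<N. F i k)"
  proof (rule sum.cong[OF refl])
    fix i
    have "(\<Sum>j=i*N..<i*N+N. F (j div N) (j mod N)) = (\<Sum>k=0..<N. F ((i*N+k) div N) ((i*N+k) mod N))"
      by (subst sum.atLeastLessThan_shift_0) simp
    also have "\<dots> = (\<Sum>k<N. F i k)"
      unfolding lessThan_atLeast0 using assms by (intro sum.cong refl) simp
    finally show "(\<Sum>j=i*N..<i*N+N. F (j div N) (j mod N)) = (\<Sum>k<N. F i k)" .
  qed
  finally show ?thesis .
qed

definition node :: "real \<Rightarrow> real \<Rightarrow> nat \<Rightarrow> nat \<Rightarrow> real" where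
  "node a b n i = a + real i * ((b - a) / real n)"

lemma node_Suc: "node a b n (Suc i) = node a b n i + (b - a) / real n"
  by (simp add: node_def distrib_right add_divide_distrib)

lemma node_bounds:
  assumes "a < b" "i \<le> n" "0 < n"
  shows "a \<le> node a b n i" "node a b n i \<le> b"
proof -
  show "a \<le> node a b n i" using assms by (simp add: node_def)
  have "real i * ((b - a) / real n) \<le> real n * ((b - a) / real n)"
    using assms by (intro mult_right_mono) auto
  then show "node a b n i \<le> b" using assms by (simp add: node_def)
qed

lemma node_refine: "0 < N \<Longrightarrow> node a b (n * N) (i * N) = node a b n i"
  by (simp add: node_def)

lemma node_cover:
  assumes "a < b" "0 < M"
  shows "{node a b M m..node a b M (m + N)} \<subseteq> {node a b M m} \<union> (\<Union>k<N. {node a b M (m + k)..node a b M (Suc (m + k))})"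
proof (induction N)
  case (Suc N)
  have "{node a b M m..node a b M (m + Suc N)}
    \<subseteq> {node a b M m..node a b M (m + N)} \<union> {node a b M (m + N)..node a b M (Suc (m + N))}"
    by auto
  then show ?case using Suc by (auto simp: lessThan_Suc)
qed auto

text \<open>
  The seminorms are \<open>T M v x y h = \<Sum> v\<^sub>j\<^sup>P\<^sup>-\<^sup>1 \<bar>h (\<gamma> x\<^sub>j) - h (\<gamma> y\<^sub>j)\<bar>\<close>, with one pair of points in each
  of \<open>M\<close> equal intervals and \<open>v\<close> regarded as a step function of \<open>L_P\<close> norm at most 1. If \<open>g\<close>
  dominates \<open>h \<circ> \<gamma>\<close> then \<open>T M v x y h \<le> \<integral> v\<^sup>P\<^sup>-\<^sup>1 g \<le> 1 + \<integral> g\<^sup>P\<close>, so that uniform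
  boundedness applies. It is used for the function found in \<open>fine_oscillation\<close> and for \<open>v\<close> equal to the
  normalised difference quotients of \<open>\<gamma>\<close> on \<open>n\<close> intervals: by duality, testing with this \<open>v\<close>
  gives back their \<open>L_P\<close> norm.
\<close>

lemma uniform_difference_quotient_bound:
  fixes \<gamma> :: "real \<Rightarrow> 'x::metric_space"
  assumes ab: "a < b" and P: "1 \<le> P" and cont: "continuous_on {a..b} \<gamma>"
    and dom: "\<And>L h. L-lipschitz_on UNIV (h :: 'x \<Rightarrow> real) \<Longrightarrow>
      \<exists>g. integrable (lebesgue_on {a..b}) g \<and> integrable (lebesgue_on {a..b}) (\<lambda>t. \<bar>g t\<bar> powr P) \<and>
        (\<forall>t\<in>{a..b}. 0 \<le> g t) \<and>
        (\<forall>u v x y. a \<le> u \<and> v \<le> b \<and> x \<in> {u..v} \<and> y \<in> {u..v} \<longrightarrow>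
          \<bar>h (\<gamma> x) - h (\<gamma> y)\<bar> \<le> (LINT \<tau>:{u..v}|lebesgue. g \<tau>))"
  shows "\<exists>C. \<forall>n>0. (\<Sum>i<n. (dist (\<gamma> (node a b n i)) (\<gamma> (node a b n (Suc i))) / ((b - a) / n)) powr P * ((b - a) / n)) \<le> C"
proof -
  define T where "T M v x y h = (\<Sum>j<M. v j powr (P - 1) * \<bar>h (\<gamma> (x j)) - h (\<gamma> (y j))\<bar>)"
    for M :: nat and v x y :: "nat \<Rightarrow> real" and h :: "'x \<Rightarrow> real"
  define ok where "ok M v x y \<longleftrightarrow> 0 < M \<and> (b - a) / M * (\<Sum>j<M. v j powr P) \<le> 1 \<and>
      (\<forall>j<M. 0 \<le> v j \<and> x j \<in> {node a b M j..node a b M (Suc j)} \<and> y j \<in> {node a b M j..node a b M (Suc j)})"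
    for M :: nat and v x y :: "nat \<Rightarrow> real"
  have "\<exists>C. \<forall>F\<in>{T M v x y | M v x y. ok M v x y}. \<forall>f. 1-lipschitz_on UNIV f \<longrightarrow> F f \<le> C"
  proof (rule lipschitz_uniform_boundedness)
    fix F and f g :: "'x \<Rightarrow> real" assume "F \<in> {T M v x y | M v x y. ok M v x y}"
    then obtain M v x y where F: "F = T M v x y" by blast
    have "v j powr (P - 1) * \<bar>f (\<gamma> (x j)) + g (\<gamma> (x j)) - (f (\<gamma> (y j)) + g (\<gamma> (y j)))\<bar>
        \<le> v j powr (P - 1) * \<bar>f (\<gamma> (x j)) - f (\<gamma> (y j))\<bar> + v j powr (P - 1) * \<bar>g (\<gamma> (x j)) - g (\<gamma> (y j))\<bar>" for j
      unfolding distrib_left[symmetric] by (intro mult_left_mono) auto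
    then show "F (\<lambda>x. f x + g x) \<le> F f + F g"
      unfolding F T_def sum.distrib[symmetric] by (rule sum_mono)
  next
    fix F and f :: "'x \<Rightarrow> real" and c :: real assume "F \<in> {T M v x y | M v x y. ok M v x y}"
    then obtain M v x y where F: "F = T M v x y" by blast
    have "\<bar>c * f z - c * f w\<bar> = \<bar>c\<bar> * \<bar>f z - f w\<bar>" for z w
      by (simp add: abs_mult right_diff_distrib[symmetric])
    then show "F (\<lambda>x. c * f x) = \<bar>c\<bar> * F f"
      unfolding F T_def sum_distrib_left by (intro sum.cong refl) (simp add: mult.left_commute)
  next
    fix F assume "F \<in> {T M v x y | M v x y. ok M v x y}"
    then obtain M v x y where F: "F = T M v x y" by blast
    have "F f \<le> (\<Sum>j<M. v j powr (P - 1) * dist (\<gamma> (x j)) (\<gamma> (y j))) * L" if f: "L-lipschitz_on UNIV f" for L f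
    proof -
      have "\<bar>f z - f w\<bar> \<le> dist z w * L" for z w
        using lipschitz_onD[OF f, of z w] by (simp add: dist_real_def mult.commute)
      then show ?thesis unfolding F T_def sum_distrib_right mult.assoc
        by (intro sum_mono mult_left_mono) auto
    qed
    then show "\<exists>B. \<forall>L f. L-lipschitz_on UNIV f \<longrightarrow> F f \<le> B * L" by blast
  next
    fix L and h :: "'x \<Rightarrow> real" assume "L-lipschitz_on UNIV h"
    from dom[OF this] obtain g where g: "integrable (lebesgue_on {a..b}) g"
      and gP: "integrable (lebesgue_on {a..b}) (\<lambda>t. \<bar>g t\<bar> powr P)" and g0: "\<And>t. t \<in> {a..b} \<Longrightarrow> 0 \<le> g t"
      and gi: "\<And>u v x y. a \<le> u \<Longrightarrow> v \<le> b \<Longrightarrow> x \<in> {u..v} \<Longrightarrow> y \<in> {u..v} \<Longrightarrow>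
        \<bar>h (\<gamma> x) - h (\<gamma> y)\<bar> \<le> (LINT \<tau>:{u..v}|lebesgue. g \<tau>)"
      by blast
    define G where "G x = integral {a..x} (\<lambda>t. \<bar>g t\<bar> powr P)" for x
    have "T M v x y h \<le> 1 + (G b - G a)" if ok: "ok M v x y" for M v x y
    proof -
      have M: "0 < M" and vP: "(b - a) / M * (\<Sum>j<M. v j powr P) \<le> 1" using ok by (auto simp: ok_def)
      have "v j powr (P - 1) * \<bar>h (\<gamma> (x j)) - h (\<gamma> (y j))\<bar>
        \<le> v j powr P * ((b - a) / M) + (G (node a b M (Suc j)) - G (node a b M j))" if j: "j < M" for j
      proof -
        let ?u = "node a b M j" and ?v = "node a b M (Suc j)"
        have uv: "a \<le> ?u" "?u \<le> ?v" "?v \<le> b"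
          using node_bounds[OF ab, of j M] node_bounds[OF ab, of "Suc j" M] j ab by (auto simp: node_Suc)
        have xy: "x j \<in> {?u..?v}" "y j \<in> {?u..?v}" "0 \<le> v j" using ok j by (auto simp: ok_def)
        have si: "set_integrable lebesgue {?u..?v} g" "set_integrable lebesgue {?u..?v} (\<lambda>t. \<bar>g t\<bar> powr P)"
          using uv g gP by (auto intro: set_integrable_lebesgue_subinterval)
        have sc: "set_integrable lebesgue {?u..?v} (\<lambda>t. v j powr P)"
          by (rule set_integrable_lebesgue_subinterval[of a b]) (use uv in auto)
        have "v j powr (P - 1) * \<bar>h (\<gamma> (x j)) - h (\<gamma> (y j))\<bar> \<le> v j powr (P - 1) * (LINT \<tau>:{?u..?v}|lebesgue. g \<tau>)"
          using uv xy by (intro mult_left_mono gi) auto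
        also have "\<dots> = (LINT \<tau>:{?u..?v}|lebesgue. v j powr (P - 1) * g \<tau>)" by simp
        also have "\<dots> \<le> (LINT \<tau>:{?u..?v}|lebesgue. v j powr P + \<bar>g \<tau>\<bar> powr P)"
        proof (rule set_integral_mono)
          show "set_integrable lebesgue {?u..?v} (\<lambda>\<tau>. v j powr (P - 1) * g \<tau>)" using si(1) by simp
          show "set_integrable lebesgue {?u..?v} (\<lambda>\<tau>. v j powr P + \<bar>g \<tau>\<bar> powr P)"
            using sc si(2) by (rule set_integral_add)
          fix t assume "t \<in> {?u..?v}"
          then have "0 \<le> g t" using uv by (intro g0) auto
          then show "v j powr (P - 1) * g t \<le> v j powr P + \<bar>g t\<bar> powr P"
            using powr_mult_le_sum_powr[OF P xy(3)] by simp
        qed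
        also have "\<dots> = (LINT \<tau>:{?u..?v}|lebesgue. v j powr P) + (LINT \<tau>:{?u..?v}|lebesgue. \<bar>g \<tau>\<bar> powr P)"
          by (rule set_integral_add(2)[OF sc si(2)])
        also have "(LINT \<tau>:{?u..?v}|lebesgue. v j powr P) = v j powr P * ((b - a) / M)"
          using uv(2) by (simp add: set_lebesgue_integral_def node_Suc)
        also have "(LINT \<tau>:{?u..?v}|lebesgue. \<bar>g \<tau>\<bar> powr P) = G ?v - G ?u"
          unfolding G_def by (rule set_integral_eq_diff[OF gP uv])
        finally show ?thesis .
      qed
      then have "T M v x y h \<le> (\<Sum>j<M. v j powr P * ((b - a) / M) + (G (node a b M (Suc j)) - G (node a b M j)))"
        unfolding T_def by (intro sum_mono) auto
      also have "\<dots> = (b - a) / M * (\<Sum>j<M. v j powr P) + (G (node a b M M) - G (node a b M 0))"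
        by (simp add: sum.distrib sum_distrib_left mult.commute sum_lessThan_telescope[of "\<lambda>j. G (node a b M j)"])
      also have "\<dots> \<le> 1 + (G b - G a)" using vP M by (simp add: node_def)
      finally show ?thesis .
    qed
    then show "\<exists>B. \<forall>F\<in>{T M v x y | M v x y. ok M v x y}. F h \<le> B" by blast
  qed
  then obtain C where C: "\<And>M v x y f. ok M v x y \<Longrightarrow> 1-lipschitz_on UNIV f \<Longrightarrow> T M v x y f \<le> C" by blast
  have "(\<Sum>i<n. (dist (\<gamma> (node a b n i)) (\<gamma> (node a b n (Suc i))) / ((b - a) / n)) powr P * ((b - a) / n)) \<le> \<bar>8 * C\<bar> powr P"
    if n: "0 < n" for n :: nat
  proof -
    define \<delta> where "\<delta> = (b - a) / n"
    have \<delta>: "0 < \<delta>" using ab n by (simp add: \<delta>_def)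
    define d where "d i = dist (\<gamma> (node a b n i)) (\<gamma> (node a b n (Suc i)))" for i
    define A where "A = (\<Sum>i<n. (d i / \<delta>) powr P * \<delta>)"
    have A0: "0 \<le> A" unfolding A_def using \<delta> by (intro sum_nonneg) auto
    show ?thesis
    proof (cases "A = 0")
      case True then show ?thesis by (simp add: A_def d_def \<delta>_def)
    next
      case False
      define \<alpha> where "\<alpha> = A powr (1 / P)"
      have \<alpha>: "0 < \<alpha>" "\<alpha> powr P = A" using False A0 P by (auto simp: \<alpha>_def powr_powr)
      define e where "e i = d i / \<delta> / \<alpha>" for i
      have e0: "0 \<le> e i" for i using \<alpha> \<delta> by (simp add: e_def d_def)
      have eP: "(\<Sum>i<n. e i powr P * \<delta>) = 1"
      proof -
        have "e i powr P * \<delta> = (d i / \<delta>) powr P * \<delta> / A" for i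
          using powr_divide[of "d i / \<delta>" \<alpha> P] \<alpha> \<delta> by (simp add: e_def d_def del: divide_divide_eq_left)
        then have "(\<Sum>i<n. e i powr P * \<delta>) = (\<Sum>i<n. (d i / \<delta>) powr P * \<delta>) / A"
          by (simp only: sum_divide_distrib)
        then show ?thesis using False by (simp add: A_def)
      qed
      have main: "(\<Sum>i<n. e i powr (P - 1) * (d i - \<epsilon>)) \<le> 8 * C" if \<epsilon>: "0 < \<epsilon>" for \<epsilon>
      proof -
        have st: "a \<le> node a b n i \<and> node a b n i \<le> node a b n (Suc i) \<and> node a b n (Suc i) \<le> b" if "i \<in> {..<n}" for i
          using node_bounds[OF ab, of i n] node_bounds[OF ab, of "Suc i" n] that ab by (auto simp: node_Suc)
        obtain h \<eta> where h: "2-lipschitz_on UNIV h" and \<eta>: "0 < \<eta>"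
          and H: "\<And>i N u v. i \<in> {..<n} \<Longrightarrow> \<forall>k<N. a \<le> u k \<and> u k \<le> v k \<and> v k \<le> b \<and> v k - u k < \<eta> \<Longrightarrow>
            {node a b n i..node a b n (Suc i)} \<subseteq> (\<Union>k<N::nat. {u k..v k}) \<Longrightarrow>
            \<exists>x y. (\<forall>k<N. x k \<in> {u k..v k} \<and> y k \<in> {u k..v k}) \<and>
              dist (\<gamma> (node a b n i)) (\<gamma> (node a b n (Suc i))) - \<epsilon> \<le> 4 * (\<Sum>k<N. \<bar>h (\<gamma> (x k)) - h (\<gamma> (y k))\<bar>)"
          using fine_oscillation[of "{..<n}" a "node a b n" "\<lambda>i. node a b n (Suc i)" b, OF _ st cont \<epsilon>]
          by auto
        obtain N :: nat where N: "(b - a) / \<eta> < real N" using reals_Archimedean2 by blast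
        have N0: "0 < N" using N ab \<eta> by (metis diff_gt_0_iff_gt divide_pos_pos gr0I of_nat_0 order_less_asym)
        \<comment> \<open>Each of the \<open>n\<close> intervals is cut into \<open>N\<close> parts, fine enough for the oscillation estimate.\<close>
        define M where "M = n * N"
        have M0: "0 < M" using n N0 by (simp add: M_def)
        have mesh: "(b - a) / M < \<eta>"
        proof -
          have "(b - a) / M \<le> (b - a) / N" using ab n N0 by (intro divide_left_mono) (auto simp: M_def)
          also have "\<dots> < \<eta>" using N \<eta> N0 by (simp add: field_simps)
          finally show ?thesis .
        qed
        define R where "R i x y \<longleftrightarrow> (\<forall>k<N. x k \<in> {node a b M (i*N+k)..node a b M (Suc (i*N+k))} \<and> y k \<in> {node a b M (i*N+k)..node a b M (Suc (i*N+k))}) \<and>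
              d i - \<epsilon> \<le> 4 * (\<Sum>k<N. \<bar>h (\<gamma> (x k)) - h (\<gamma> (y k))\<bar>)" for i x y
        have "\<exists>x y. R i x y" if i: "i < n" for i
          unfolding R_def d_def
        proof (rule H)
          show "i \<in> {..<n}" using i by simp
          have "Suc (i*N+k) \<le> M" if "k < N" for k
          proof -
            have "Suc i * N \<le> n * N" using i by (intro mult_right_mono) auto
            then show ?thesis using that by (simp add: M_def)
          qed
          then have "node a b M (Suc (i*N+k)) \<le> b" "a \<le> node a b M (i*N+k)" if "k < N" for k
            using node_bounds[OF ab _ M0] that by (auto simp: Suc_le_eq less_imp_le)
          then show "\<forall>k<N. a \<le> node a b M (i*N+k) \<and> node a b M (i*N+k) \<le> node a b M (Suc (i*N+k)) \<and>
              node a b M (Suc (i*N+k)) \<le> b \<and> node a b M (Suc (i*N+k)) - node a b M (i*N+k) < \<eta>"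
            using mesh ab by (simp add: node_Suc)
          have "node a b n i = node a b M (i*N)" "node a b n (Suc i) = node a b M (i*N+N)"
            using node_refine[OF N0, of a b n i] node_refine[OF N0, of a b n "Suc i"] by (simp_all add: M_def add.commute)
          moreover have "node a b M (i*N) \<in> (\<Union>k<N. {node a b M (i*N+k)..node a b M (Suc (i*N+k))})"
            using N0 ab by (intro UN_I[of 0]) (auto simp: node_Suc)
          then have "{node a b M (i*N)..node a b M (i*N+N)} \<subseteq> (\<Union>k<N. {node a b M (i*N+k)..node a b M (Suc (i*N+k))})"
            using node_cover[OF ab M0, of "i*N" N] by blast
          ultimately show "{node a b n i..node a b n (Suc i)} \<subseteq> (\<Union>k<N. {node a b M (i*N+k)..node a b M (Suc (i*N+k))})"
            by (simp only:)
        qed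
        then obtain x y where R: "\<And>i. i < n \<Longrightarrow> R i (x i) (y i)" by metis
        have xy: "x i k \<in> {node a b M (i*N+k)..node a b M (Suc (i*N+k))} \<and> y i k \<in> {node a b M (i*N+k)..node a b M (Suc (i*N+k))}"
          if "i < n" "k < N" for i k
          using R[OF that(1)] that(2) unfolding R_def by blast
        have dl: "d i - \<epsilon> \<le> 4 * (\<Sum>k<N. \<bar>h (\<gamma> (x i k)) - h (\<gamma> (y i k))\<bar>)" if "i < n" for i
          using R[OF that] unfolding R_def by blast
        define v where "v j = e (j div N)" for j
        define X where "X j = x (j div N) (j mod N)" for j
        define Y where "Y j = y (j div N) (j mod N)" for j
        have "ok M v X Y" unfolding ok_def
        proof (intro conjI allI impI)
          have "(\<Sum>j<M. v j powr P) = (\<Sum>i<n. \<Sum>k<N. e i powr P)"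
            unfolding v_def M_def using sum_div_mod[OF N0, of "\<lambda>i k. e i powr P"] .
          also have "\<dots> = N * (\<Sum>i<n. e i powr P)" by (simp add: sum_distrib_left)
          also have "(b - a) / M * \<dots> = (\<Sum>i<n. e i powr P) * \<delta>"
            using N0 by (simp add: M_def \<delta>_def)
          also have "\<dots> = (\<Sum>i<n. e i powr P * \<delta>)" by (simp only: sum_distrib_right)
          finally show "(b - a) / M * (\<Sum>j<M. v j powr P) \<le> 1" using eP by simp
          fix j assume j: "j < M"
          then have ji: "j div N < n" "j mod N < N" using N0 by (auto simp: M_def less_mult_imp_div_less)
          have "j div N * N + j mod N = j" by simp
          then show "X j \<in> {node a b M j..node a b M (Suc j)}" "Y j \<in> {node a b M j..node a b M (Suc j)}"
            using xy[OF ji] by (simp_all add: X_def Y_def)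
        qed (use M0 e0 in \<open>auto simp: v_def\<close>)
        moreover have "1-lipschitz_on UNIV (\<lambda>z. (1/2) * h z)" using lipschitz_on_cmult_real[OF h, of "1/2"] by simp
        ultimately have "T M v X Y (\<lambda>z. (1/2) * h z) \<le> C" by (rule C)
        also have "T M v X Y (\<lambda>z. (1/2) * h z) = (\<Sum>i<n. \<Sum>k<N. e i powr (P - 1) * \<bar>(1/2) * h (\<gamma> (x i k)) - (1/2) * h (\<gamma> (y i k))\<bar>)"
          unfolding T_def v_def X_def Y_def M_def
          using sum_div_mod[OF N0, of "\<lambda>i k. e i powr (P - 1) * \<bar>(1/2) * h (\<gamma> (x i k)) - (1/2) * h (\<gamma> (y i k))\<bar>"] .
        finally have le: "(\<Sum>i<n. \<Sum>k<N. e i powr (P - 1) * \<bar>(1/2) * h (\<gamma> (x i k)) - (1/2) * h (\<gamma> (y i k))\<bar>) \<le> C" .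
        have "(\<Sum>i<n. e i powr (P - 1) * (d i - \<epsilon>)) \<le> (\<Sum>i<n. e i powr (P - 1) * (4 * (\<Sum>k<N. \<bar>h (\<gamma> (x i k)) - h (\<gamma> (y i k))\<bar>)))"
          using dl by (intro sum_mono mult_left_mono) auto
        also have "\<dots> = (\<Sum>i<n. \<Sum>k<N. 8 * (e i powr (P - 1) * (\<bar>h (\<gamma> (x i k)) - h (\<gamma> (y i k))\<bar> / 2)))"
          by (simp add: sum_distrib_left mult.left_commute)
        also have "\<dots> = (\<Sum>i<n. \<Sum>k<N. 8 * (e i powr (P - 1) * \<bar>(1/2) * h (\<gamma> (x i k)) - (1/2) * h (\<gamma> (y i k))\<bar>))"
        proof -
          have "\<bar>(1/2) * z - (1/2) * w\<bar> = \<bar>z - w\<bar> / 2" for z w :: real by (simp add: abs_if)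
          then show ?thesis by (simp only:)
        qed
        also have "\<dots> = 8 * (\<Sum>i<n. \<Sum>k<N. e i powr (P - 1) * \<bar>(1/2) * h (\<gamma> (x i k)) - (1/2) * h (\<gamma> (y i k))\<bar>)"
          by (simp only: sum_distrib_left)
        also have "\<dots> \<le> 8 * C" using le by simp
        finally show ?thesis .
      qed
      \<comment> \<open>The factor 8: 4 from the oscillation estimate, 2 from the Lipschitz constant of \<open>h\<close>.\<close>
      have "(\<Sum>i<n. e i powr (P - 1) * d i) \<le> 8 * C"
      proof (rule field_le_epsilon)
        fix \<epsilon> :: real assume \<epsilon>: "0 < \<epsilon>"
        define S where "S = (\<Sum>i<n. e i powr (P - 1))"
        have S: "0 \<le> S" unfolding S_def by (intro sum_nonneg) auto
        have "(\<Sum>i<n. e i powr (P - 1) * (d i - \<epsilon> / (S + 1))) \<le> 8 * C" using \<epsilon> S by (intro main) auto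
        moreover have shift: "(\<Sum>i<n. e i powr (P - 1) * (d i - q)) = (\<Sum>i<n. e i powr (P - 1) * d i) - S * q" for q
          by (simp only: right_diff_distrib sum_subtractf S_def sum_distrib_right)
        moreover have "S * (\<epsilon> / (S + 1)) \<le> \<epsilon>" using S \<epsilon> by (simp add: field_simps)
        ultimately show "(\<Sum>i<n. e i powr (P - 1) * d i) \<le> 8 * C + \<epsilon>"
          using shift[of "\<epsilon> / (S + 1)"] by linarith
      qed
      moreover have "(\<Sum>i<n. e i powr (P - 1) * d i) = \<alpha>"
      proof -
        have "e i powr (P - 1) * d i = \<alpha> * (e i powr P * \<delta>)" for i
        proof -
          have "d i = e i * \<alpha> * \<delta>" using \<alpha> \<delta> by (simp add: e_def)
          then have "e i powr (P - 1) * d i = \<alpha> * ((e i * e i powr (P - 1)) * \<delta>)" by (simp only: mult_ac)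
          then show ?thesis using powr_mult_base[OF e0[of i], of "P - 1"] by simp
        qed
        then have "(\<Sum>i<n. e i powr (P - 1) * d i) = \<alpha> * (\<Sum>i<n. e i powr P * \<delta>)" by (simp add: sum_distrib_left)
        then show ?thesis using eP by simp
      qed
      ultimately have "\<alpha> \<le> \<bar>8 * C\<bar>" by linarith
      then have "A \<le> \<bar>8 * C\<bar> powr P" using \<alpha> P powr_mono2[of P \<alpha> "\<bar>8 * C\<bar>"] by simp
      then show ?thesis by (simp add: A_def d_def \<delta>_def)
    qed
  qed
  then show ?thesis by blast
qed

section \<open>Densities and differentiation\<close>

lemma nn_integral_Ioc_eq_diff:
  fixes g :: "real \<Rightarrow> real"
  assumes g: "integrable (lebesgue_on {a..b}) g" and g0: "\<And>t. t \<in> {a..b} \<Longrightarrow> 0 \<le> g t"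
    and xy: "a \<le> x" "x \<le> y" "y \<le> b"
  shows "(\<integral>\<^sup>+t. ennreal (g t) * indicator {x<..y} t \<partial>lebesgue) = ennreal (integral {a..y} g - integral {a..x} g)"
proof -
  have si: "integrable lebesgue (\<lambda>t. indicator {x..y} t * g t)"
    using set_integrable_lebesgue_subinterval[OF g, of x y] xy by (simp add: set_integrable_def)
  have "(\<integral>\<^sup>+t. ennreal (g t) * indicator {x<..y} t \<partial>lebesgue) = (\<integral>\<^sup>+t. ennreal (indicator {x..y} t * g t) \<partial>lebesgue)"
  proof (rule nn_integral_cong_AE)
    have "AE t in lebesgue. t \<noteq> x" by (intro AE_completion AE_lborel_singleton)
    then show "AE t in lebesgue. ennreal (g t) * indicator {x<..y} t = ennreal (indicator {x..y} t * g t)"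
      by eventually_elim (auto simp: indicator_def)
  qed
  also have "\<dots> = ennreal (\<integral>t. indicator {x..y} t * g t \<partial>lebesgue)"
    using g0 xy by (intro nn_integral_eq_integral si AE_I2) (auto simp: indicator_def)
  also have "(\<integral>t. indicator {x..y} t * g t \<partial>lebesgue) = integral {a..y} g - integral {a..x} g"
    using set_integral_eq_diff[OF g xy] by (simp add: set_lebesgue_integral_def)
  finally show ?thesis .
qed

text \<open>
  Both \<open>\<integral> g + f\<close> and \<open>\<integral> g - f\<close> are nondecreasing and continuous. Their Stieltjes measures add up to the
  measure with density \<open>2 g\<close>, so each of them is absolutely continuous, and the first has a
  density by the Radon--Nikodym theorem; subtracting \<open>g\<close> from it gives a density for \<open>f\<close>.
\<close>

lemma dominated_function_is_integral:
  fixes f g :: "real \<Rightarrow> real"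
  assumes ab: "a < b" and g: "integrable (lebesgue_on {a..b}) g" and g0: "\<And>t. t \<in> {a..b} \<Longrightarrow> 0 \<le> g t"
    and fg: "\<And>x y. a \<le> x \<Longrightarrow> x \<le> y \<Longrightarrow> y \<le> b \<Longrightarrow> \<bar>f x - f y\<bar> \<le> (LINT \<tau>:{x..y}|lebesgue. g \<tau>)"
  shows "\<exists>\<phi>. integrable (lebesgue_on {a..b}) \<phi> \<and>
    (\<forall>x y. a \<le> x \<and> x \<le> y \<and> y \<le> b \<longrightarrow> f y - f x = (LINT \<tau>:{x..y}|lebesgue. \<phi> \<tau>))"
proof -
  define I where "I x = integral {a..x} g" for x
  define c where "c x = max a (min b x)" for x
  have c: "a \<le> c x" "c x \<le> b" for x using ab by (auto simp: c_def)
  have cmono: "x \<le> y \<Longrightarrow> c x \<le> c y" for x y by (auto simp: c_def)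
  have cid: "a \<le> x \<Longrightarrow> x \<le> b \<Longrightarrow> c x = x" for x by (auto simp: c_def)
  have fI: "\<bar>f x - f y\<bar> \<le> I y - I x" if "a \<le> x" "x \<le> y" "y \<le> b" for x y
    using fg[OF that] set_integral_eq_diff[OF g that] by (simp add: I_def)
  have hk: "g integrable_on {a..b}"
    by (rule set_lebesgue_integral_eq_integral(1)[OF set_integrable_lebesgue_subinterval[OF g]]) auto
  have ccont: "continuous_on UNIV c" unfolding c_def by (intro continuous_intros)
  have Icont: "continuous_on {a..b} I" unfolding I_def by (rule indefinite_integral_continuous_1[OF hk])
  have fcont: "continuous_on {a..b} f"
  proof (rule continuous_on_if_dominated_by_integral)
    fix z
    have "dist (dist (f x) z) (dist (f y) z) \<le> (LINT \<tau>:{x..y}|lebesgue. g \<tau>)" if "a \<le> x" "x \<le> y" "y \<le> b" for x y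
      using fg[OF that] by (simp add: dist_real_def)
    then show "\<exists>g. integrable (lebesgue_on {a..b}) g \<and> (\<forall>t\<in>{a..b}. 0 \<le> g t) \<and>
      (\<forall>x y. a \<le> x \<and> x \<le> y \<and> y \<le> b \<longrightarrow> dist (dist (f x) z) (dist (f y) z) \<le> (LINT \<tau>:{x..y}|lebesgue. g \<tau>))"
      using g g0 by blast
  qed
  define J where "J = {a<..b}"
  \<comment> \<open>The parameter \<open>s = \<plusminus>1\<close> treats both functions at once; \<open>c\<close> extends them beyond \<open>[a,b]\<close> by constants.\<close>
  define M where "M s = interval_measure (\<lambda>x. I (c x) + s * f (c x))" for s
  have Mset: "sets (M s) = sets borel" "space (M s) = UNIV" for s by (simp_all add: M_def)
  have M_Ioc: "emeasure (M s) {x<..y} = ennreal ((I y + s * f y) - (I x + s * f x))"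
    if s: "\<bar>s\<bar> = 1" and xy: "a \<le> x" "x \<le> y" "y \<le> b" for s x y
  proof -
    have "emeasure (M s) {x<..y} = ennreal ((I (c y) + s * f (c y)) - (I (c x) + s * f (c x)))"
      unfolding M_def
    proof (rule emeasure_interval_measure_Ioc[OF xy(2)])
      fix u v :: real assume "u \<le> v"
      then have "\<bar>f (c u) - f (c v)\<bar> \<le> I (c v) - I (c u)" by (intro fI c cmono)
      then show "I (c u) + s * f (c u) \<le> I (c v) + s * f (c v)" using s by (auto simp: abs_if split: if_splits)
    next
      fix u
      have "continuous_on UNIV (\<lambda>x. I (c x) + s * f (c x))"
        using c by (intro continuous_intros continuous_on_compose2[OF Icont ccont] continuous_on_compose2[OF fcont ccont]) auto
      then show "continuous (at_right u) (\<lambda>x. I (c x) + s * f (c x))"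
        by (simp add: continuous_on_eq_continuous_within continuous_at_imp_continuous_within)
    qed
    then show ?thesis using xy cid by simp
  qed
  define D where "D = density lebesgue (\<lambda>t. 2 * ennreal (g t) * indicator J t)"
  have gm: "(\<lambda>t. 2 * ennreal (g t) * indicator J t) \<in> borel_measurable lebesgue"
  proof -
    have "(\<lambda>t. indicator {a..b} t * g t) \<in> borel_measurable lebesgue"
      using set_integrable_lebesgue_subinterval[OF g, of a b] by (auto simp: set_integrable_def)
    then have "(\<lambda>t. 2 * ennreal (indicator {a..b} t * g t) * indicator J t) \<in> borel_measurable lebesgue"
      by (intro borel_measurable_times_ennreal measurable_compose[OF _ measurable_ennreal] borel_measurable_indicator)
        (auto simp: J_def)
    moreover have "(\<lambda>t. 2 * ennreal (indicator {a..b} t * g t) * indicator J t) = (\<lambda>t. 2 * ennreal (g t) * indicator J t)"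
      by (auto simp: J_def indicator_def fun_eq_iff)
    ultimately show ?thesis by simp
  qed
  define Q where "Q s = density (M s) (indicator J)" for s
  have Jm: "J \<in> sets (M s)" for s by (simp add: Mset J_def)
  have Qe: "emeasure (Q s) A = emeasure (M s) (A \<inter> J)" if "A \<in> sets borel" for s A
    unfolding Q_def using that Jm[of s]
    by (subst emeasure_density)
      (auto simp: nn_integral_indicator[symmetric] indicator_inter_arith mult.commute Mset(1) simp del: nn_integral_indicator
        intro!: borel_measurable_indicator Jm)
  have Qset: "sets (Q s) = sets borel" "space (Q s) = UNIV" for s by (simp_all add: Q_def Mset)
  have DI: "emeasure D {x<..y} = ennreal (2 * (I y - I x))" if xy: "a \<le> x" "x \<le> y" "y \<le> b" for x y
  proof -
    have "emeasure D {x<..y} = (\<integral>\<^sup>+t. 2 * (ennreal (g t) * indicator {x<..y} t) \<partial>lebesgue)"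
      unfolding D_def using gm xy by (subst emeasure_density) (auto simp: J_def indicator_def intro!: nn_integral_cong)
    also have "\<dots> = 2 * (\<integral>\<^sup>+t. ennreal (g t) * indicator {x<..y} t \<partial>lebesgue)"
    proof (rule nn_integral_cmult)
      have "(\<lambda>t. ennreal (indicator {x..y} t * g t) * indicator {x<..y} t) \<in> borel_measurable lebesgue"
        using set_integrable_lebesgue_subinterval[OF g, of x y] xy
        by (intro borel_measurable_times_ennreal measurable_compose[OF _ measurable_ennreal] borel_measurable_indicator)
          (auto simp: set_integrable_def)
      moreover have "(\<lambda>t. ennreal (indicator {x..y} t * g t) * indicator {x<..y} t) = (\<lambda>t. ennreal (g t) * indicator {x<..y} t)"
        by (auto simp: indicator_def fun_eq_iff)
      ultimately show "(\<lambda>t. ennreal (g t) * indicator {x<..y} t) \<in> borel_measurable lebesgue" by simp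
    qed
    also have "(\<integral>\<^sup>+t. ennreal (g t) * indicator {x<..y} t \<partial>lebesgue) = ennreal (I y - I x)"
      unfolding I_def by (rule nn_integral_Ioc_eq_diff[OF g _ xy]) (rule g0)
    also have "2 * ennreal (I y - I x) = ennreal (2 * (I y - I x))"
      using fI[OF xy] ennreal_mult[of 2 "I y - I x"] by simp
    finally show ?thesis .
  qed
  have D0: "emeasure D A = emeasure D (A \<inter> J)" if "A \<in> sets borel" for A
    unfolding D_def using that gm
    by (subst (1 2) emeasure_density) (auto simp: J_def indicator_def intro!: nn_integral_cong)
  have sum_eq: "emeasure (Q 1) A + emeasure (Q (-1)) A = emeasure D A" if "A \<in> sets borel" for A
  proof -
    have UN: "emeasure (Q 1) A + emeasure (Q (-1)) A = emeasure D A" if A: "A \<in> sets borel" and "A \<inter> J = {x<..y}" "a \<le> x" "x \<le> y" "y \<le> b" for A x y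
      unfolding D0[OF A] Qe[OF A] \<open>A \<inter> J = _\<close> DI[OF that(3-)]
      using that fI[OF that(3-)] by (simp add: M_Ioc ennreal_plus[symmetric] del: ennreal_plus)
    have top: "emeasure (Q 1) UNIV + emeasure (Q (-1)) UNIV = emeasure D UNIV"
      using UN[of UNIV a b] ab by (simp add: J_def)
    have Dfin: "emeasure D UNIV \<noteq> \<infinity>" using D0[of UNIV] DI[of a b] ab by (simp add: J_def)
    have A: "A \<in> sigma_sets UNIV (range (\<lambda>(s, t). {s<..t::real}))"
      using \<open>A \<in> sets borel\<close> by (subst (asm) borel_sigma_sets_Ioc) simp
    have st: "Int_stable (range (\<lambda>(s, t). {s<..t::real}))"
      by (rule Int_stableI) (force simp: Int_greaterThanAtMost)
    have sb: "B \<in> sets borel" if "B \<in> sigma_sets UNIV (range (\<lambda>(s, t). {s<..t::real}))" for B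
      using that by (subst borel_sigma_sets_Ioc) simp
    show ?thesis
    proof (induction rule: sigma_sets_induct_disjoint[OF st _ A])
      case (2 B)
      then obtain s t where B: "B = {s<..t}" by auto
      show ?case
      proof (cases "max s a \<le> min t b")
        case True
        have "B \<inter> J = {max s a<..min t b}" by (auto simp: B J_def)
        then show ?thesis using True by (intro UN) (auto simp: B)
      next
        case False
        then have "B \<inter> J = {a<..a}" by (auto simp: B J_def)
        then show ?thesis using ab by (intro UN[of _ a a]) (auto simp: B)
      qed
    next
      case 3 show ?case by simp
    next
      case (4 B)
      have B: "B \<in> sets borel" using 4(1) by (rule sb)
      have split: "emeasure N UNIV = emeasure N B + emeasure N (UNIV - B)"
        if "sets borel \<subseteq> sets N" "space N = UNIV" for N :: "real measure"
        using B that by (subst plus_emeasure) auto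
      have Dset: "sets borel \<subseteq> sets D" "space D = UNIV" by (auto simp: D_def)
      have "(emeasure (Q 1) B + emeasure (Q 1) (UNIV - B)) + (emeasure (Q (-1)) B + emeasure (Q (-1)) (UNIV - B))
          = emeasure D B + emeasure D (UNIV - B)"
        using top split[of "Q 1"] split[of "Q (-1)"] split[OF Dset] by (simp add: Qset)
      then have "emeasure D B + (emeasure (Q 1) (UNIV - B) + emeasure (Q (-1)) (UNIV - B))
          = emeasure D B + emeasure D (UNIV - B)"
        unfolding 4(2)[symmetric] by (simp only: ac_simps)
      moreover have "emeasure D B \<noteq> top"
        using Dfin emeasure_mono[of B UNIV D] by (auto simp: D_def top_unique)
      ultimately show ?case by (simp add: ennreal_add_left_cancel)
    next
      case (5 B)
      have B: "B i \<in> sets borel" for i using 5(2) sb by blast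
      have "(\<Sum>i. emeasure (Q s) (B i)) = emeasure (Q s) (\<Union>i. B i)" for s
        using B 5(1) by (intro suminf_emeasure) (auto simp: Qset)
      moreover have "(\<Sum>i. emeasure D (B i)) = emeasure D (\<Union>i. B i)"
        using B 5(1) by (intro suminf_emeasure) (auto simp: D_def)
      ultimately show ?case using 5(3) by (metis (no_types, lifting) suminf_add summableI suminf_cong)
    qed simp
  qed
  have ac: "absolutely_continuous lborel (Q 1)"
  proof (unfold absolutely_continuous_def, rule subsetI)
    fix N :: "real set" assume N: "N \<in> null_sets lborel"
    have Nb: "N \<in> sets borel" using N by auto
    have "N \<in> null_sets D"
      using null_sets_completionI[OF N] absolutely_continuousI_density[OF gm]
      by (auto simp: D_def absolutely_continuous_def)
    then have "emeasure D N = 0" by auto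
    then have "emeasure (Q 1) N = 0" using sum_eq[OF Nb] by simp
    then show "N \<in> null_sets (Q 1)" using Nb by (intro null_setsI) (auto simp: Qset)
  qed
  then obtain \<psi> where \<psi>: "\<psi> \<in> borel_measurable lborel" "density lborel \<psi> = Q 1"
    using sigma_finite_measure.Radon_Nikodym[OF lborel.sigma_finite_measure_axioms ac] by (auto simp: Qset)
  have \<psi>I: "(\<integral>\<^sup>+t. \<psi> t * indicator {x<..y} t \<partial>lborel) = ennreal ((I y + f y) - (I x + f x))"
    if "a \<le> x" "x \<le> y" "y \<le> b" for x y
  proof -
    have "(\<integral>\<^sup>+t. \<psi> t * indicator {x<..y} t \<partial>lborel) = emeasure (Q 1) {x<..y}"
      unfolding \<psi>(2)[symmetric] using \<psi>(1) by (subst emeasure_density) auto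
    also have "\<dots> = emeasure (M 1) {x<..y}" using that by (subst Qe) (auto simp: J_def intro!: arg_cong[where f="emeasure (M 1)"])
    finally show ?thesis using M_Ioc[of 1 x y] that by simp
  qed
  have fin: "AE t in lborel. \<psi> t * indicator {a<..b} t \<noteq> \<infinity>"
    using \<psi>I[of a b] ab \<psi>(1) by (intro nn_integral_PInf_AE) auto
  define \<phi>1 where "\<phi>1 t = enn2real (\<psi> t * indicator {a<..b} t)" for t
  have \<phi>1m: "\<phi>1 \<in> borel_measurable lborel" unfolding \<phi>1_def using \<psi>(1) by measurable
  have \<phi>1I: "(\<integral>\<^sup>+t. ennreal (indicator {x..y} t * \<phi>1 t) \<partial>lebesgue) = ennreal ((I y + f y) - (I x + f x))"
    if xy: "a \<le> x" "x \<le> y" "y \<le> b" for x y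
  proof -
    have "(\<integral>\<^sup>+t. ennreal (indicator {x..y} t * \<phi>1 t) \<partial>lebesgue) = (\<integral>\<^sup>+t. ennreal (indicator {x..y} t * \<phi>1 t) \<partial>lborel)"
      by (rule nn_integral_completion)
    also have "\<dots> = (\<integral>\<^sup>+t. \<psi> t * indicator {x<..y} t \<partial>lborel)"
    proof (rule nn_integral_cong_AE)
      have "AE t in lborel. t \<noteq> x" by (rule AE_lborel_singleton)
      with fin show "AE t in lborel. ennreal (indicator {x..y} t * \<phi>1 t) = \<psi> t * indicator {x<..y} t"
        by eventually_elim (use xy in \<open>auto simp: indicator_def \<phi>1_def less_top split: if_splits\<close>)
    qed
    finally show ?thesis using \<psi>I[OF xy] by simp
  qed
  have mono: "0 \<le> (I y + f y) - (I x + f x)" if "a \<le> x" "x \<le> y" "y \<le> b" for x y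
    using fI[OF that] by linarith
  have \<phi>1m': "(\<lambda>t. indicator {x..y} t * \<phi>1 t) \<in> borel_measurable lebesgue" for x y :: real
    using \<phi>1m by (intro measurable_completion borel_measurable_times borel_measurable_indicator) auto
  have \<phi>1int: "set_integrable lebesgue {x..y} \<phi>1" "(LINT t:{x..y}|lebesgue. \<phi>1 t) = (I y + f y) - (I x + f x)"
    if xy: "a \<le> x" "x \<le> y" "y \<le> b" for x y
  proof -
    have nn: "0 \<le> indicator {x..y} t * \<phi>1 t" for t by (simp add: \<phi>1_def)
    show "set_integrable lebesgue {x..y} \<phi>1"
      unfolding set_integrable_def using \<phi>1I[OF xy] nn \<phi>1m' by (intro integrableI_nonneg) auto
    show "(LINT t:{x..y}|lebesgue. \<phi>1 t) = (I y + f y) - (I x + f x)"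
      unfolding set_lebesgue_integral_def using \<phi>1I[OF xy] nn \<phi>1m' mono[OF xy]
      by (subst integral_eq_nn_integral) auto
  qed
  show ?thesis
  proof (intro exI conjI allI impI)
    have "integrable (lebesgue_on {a..b}) \<phi>1"
      using \<phi>1int(1)[of a b] ab by (simp add: set_integrable_def integrable_restrict_space)
    then show "integrable (lebesgue_on {a..b}) (\<lambda>t. \<phi>1 t - g t)" using g by simp
    fix x y assume "a \<le> x \<and> x \<le> y \<and> y \<le> b"
    then have xy: "a \<le> x" "x \<le> y" "y \<le> b" by auto
    have "(LINT t:{x..y}|lebesgue. \<phi>1 t - g t) = (LINT t:{x..y}|lebesgue. \<phi>1 t) - (LINT t:{x..y}|lebesgue. g t)"
      using \<phi>1int(1)[OF xy] set_integrable_lebesgue_subinterval[OF g xy(1,3)] by (rule set_integral_diff)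
    also have "\<dots> = f y - f x" using \<phi>1int(2)[OF xy] set_integral_eq_diff[OF g xy] by (simp add: I_def)
    finally show "f y - f x = (LINT t:{x..y}|lebesgue. \<phi>1 t - g t)" by simp
  qed
qed

text \<open>
  Averages over arbitrary small intervals containing \<open>t\<close>, obtained from the one-sided differentiation
  theorem for \<open>\<phi>\<close> and for its reflection: an average over \<open>[u, v]\<close> is a convex combination of
  those over \<open>[u, t]\<close> and \<open>[t, v]\<close>.
\<close>

lemma lebesgue_differentiation_interval:
  fixes \<phi> :: "real \<Rightarrow> real"
  assumes \<phi>: "integrable (lebesgue_on {a..b}) \<phi>"
  shows "\<exists>N. negligible N \<and> (\<forall>t \<epsilon>. t \<notin> N \<longrightarrow> 0 < \<epsilon> \<longrightarrow>
    (\<exists>d>0. \<forall>u v. a \<le> u \<and> u \<le> t \<and> t \<le> v \<and> v \<le> b \<and> u < v \<and> v - u < d \<longrightarrow>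
      \<bar>(LINT \<tau>:{u..v}|lebesgue. \<phi> \<tau>) / (v - u) - \<phi> t\<bar> \<le> \<epsilon>))"
proof -
  define \<phi>0 where "\<phi>0 t = (if t \<in> {a..b} then \<phi> t else 0)" for t
  have "integrable lebesgue (\<lambda>t. indicator {a..b} t * \<phi> t)"
    using set_integrable_lebesgue_subinterval[OF \<phi>, of a b] by (simp add: set_integrable_def)
  moreover have "(\<lambda>t. indicator {a..b} t * \<phi> t) = \<phi>0" by (auto simp: \<phi>0_def indicator_def)
  ultimately have int0: "integrable lebesgue \<phi>0" by simp
  have box: "\<phi>0 integrable_on cbox x y" for x y
    using int0 integrable_on_lebesgue integrable_on_subcbox by blast
  have box': "(\<lambda>t. \<phi>0 (- t)) integrable_on cbox x y" for x y
    using box[of "-y" "-x"] Henstock_Kurzweil_Integration.integrable_reflect_real[of \<phi>0 "-x" "-y"] by simp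
  obtain N1 where N1: "negligible N1" and right: "\<And>x e. x \<notin> N1 \<Longrightarrow> 0 < e \<Longrightarrow>
      \<exists>d>0. \<forall>h. 0 < h \<and> h < d \<longrightarrow> norm (integral (cbox x (x + h *\<^sub>R One)) \<phi>0 /\<^sub>R h ^ DIM(real) - \<phi>0 x) < e"
    using integrable_ccontinuous_explicit[of \<phi>0] box by blast
  obtain N2 where N2: "negligible N2" and left: "\<And>x e. x \<notin> N2 \<Longrightarrow> 0 < e \<Longrightarrow>
      \<exists>d>0. \<forall>h. 0 < h \<and> h < d \<longrightarrow> norm (integral (cbox x (x + h *\<^sub>R One)) (\<lambda>t. \<phi>0 (- t)) /\<^sub>R h ^ DIM(real) - \<phi>0 (- x)) < e"
    using integrable_ccontinuous_explicit[of "\<lambda>t. \<phi>0 (- t)"] box' by blast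
  have "negligible (N1 \<union> uminus ` N2)"
    using N1 N2 by (intro negligible_Un negligible_differentiable_image_negligible) (auto intro!: derivative_intros)
  moreover have "\<exists>d>0. \<forall>u v. a \<le> u \<and> u \<le> t \<and> t \<le> v \<and> v \<le> b \<and> u < v \<and> v - u < d \<longrightarrow>
      \<bar>(LINT \<tau>:{u..v}|lebesgue. \<phi> \<tau>) / (v - u) - \<phi> t\<bar> \<le> \<epsilon>"
    if t: "t \<notin> N1 \<union> uminus ` N2" and e: "0 < \<epsilon>" for t \<epsilon>
  proof -
    have "t \<notin> N1" "- t \<notin> N2" using t by force+
    from right[OF this(1) e] obtain d1 where d1: "d1 > 0"
      and R: "\<And>h. 0 < h \<Longrightarrow> h < d1 \<Longrightarrow> \<bar>integral {t..t + h} \<phi>0 / h - \<phi>0 t\<bar> < \<epsilon>"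
      by (auto simp: divide_inverse mult.commute)
    from left[OF \<open>- t \<notin> N2\<close> e] obtain d2 where d2: "d2 > 0"
      and L': "\<And>h. 0 < h \<Longrightarrow> h < d2 \<Longrightarrow> \<bar>integral {-t..-t + h} (\<lambda>s. \<phi>0 (-s)) / h - \<phi>0 t\<bar> < \<epsilon>"
      by (auto simp: divide_inverse mult.commute)
    have L: "\<bar>integral {t - h..t} \<phi>0 / h - \<phi>0 t\<bar> < \<epsilon>" if "0 < h" "h < d2" for h
      using L'[OF that] Henstock_Kurzweil_Integration.integral_reflect_real[of t "t - h" \<phi>0] by (simp add: add.commute)
    have close: "\<bar>z - h * w\<bar> \<le> \<epsilon> * h" if "\<bar>z / h - w\<bar> < \<epsilon>" "0 < h" for z w h :: real
    proof -
      have "z - h * w = h * (z / h - w)" using that by (simp add: right_diff_distrib)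
      then have "\<bar>z - h * w\<bar> = h * \<bar>z / h - w\<bar>" using that by (simp add: abs_mult)
      then show ?thesis using that by (simp add: mult.commute)
    qed
    show ?thesis
    proof (intro exI[of _ "min d1 d2"] conjI allI impI)
      show "0 < min d1 d2" using d1 d2 by simp
      fix u v assume "a \<le> u \<and> u \<le> t \<and> t \<le> v \<and> v \<le> b \<and> u < v \<and> v - u < min d1 d2"
      then have uv: "a \<le> u" "u \<le> t" "t \<le> v" "v \<le> b" "u < v" "v - u < d1" "v - u < d2" by auto
      have "\<bar>integral {t..v} \<phi>0 - (v - t) * \<phi>0 t\<bar> \<le> \<epsilon> * (v - t)"
        using close[OF R[of "v - t"]] uv by (cases "t = v") auto
      moreover have "\<bar>integral {u..t} \<phi>0 - (t - u) * \<phi>0 t\<bar> \<le> \<epsilon> * (t - u)"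
        using close[OF L[of "t - u"]] uv by (cases "t = u") auto
      moreover have "integral {u..t} \<phi>0 + integral {t..v} \<phi>0 = integral {u..v} \<phi>0"
        using uv box[of u v] by (intro Henstock_Kurzweil_Integration.integral_combine) auto
      moreover have "integral {u..v} \<phi>0 = integral {u..v} \<phi>"
        using uv by (intro integral_cong) (auto simp: \<phi>0_def)
      moreover have "(LINT \<tau>:{u..v}|lebesgue. \<phi> \<tau>) = integral {u..v} \<phi>"
        using set_integrable_lebesgue_subinterval[OF \<phi> uv(1,4)] by (rule set_lebesgue_integral_eq_integral(2))
      moreover have "\<phi>0 t = \<phi> t" using uv by (simp add: \<phi>0_def)
      ultimately have "\<bar>(LINT \<tau>:{u..v}|lebesgue. \<phi> \<tau>) - (v - u) * \<phi> t\<bar> \<le> \<epsilon> * (v - u)"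
        by (simp add: left_diff_distrib right_diff_distrib)
      moreover have "(LINT \<tau>:{u..v}|lebesgue. \<phi> \<tau>) / (v - u) - \<phi> t = ((LINT \<tau>:{u..v}|lebesgue. \<phi> \<tau>) - (v - u) * \<phi> t) / (v - u)"
        using uv by (simp add: diff_divide_distrib)
      ultimately show "\<bar>(LINT \<tau>:{u..v}|lebesgue. \<phi> \<tau>) / (v - u) - \<phi> t\<bar> \<le> \<epsilon>"
        using uv by (simp add: abs_divide pos_divide_le_eq)
    qed
  qed
  ultimately show ?thesis by blast
qed

section \<open>The dominating function\<close>

lemma nn_integral_const_indicator_Ico:
  fixes u v c :: real
  assumes "u \<le> v" "0 \<le> c"
  shows "(\<integral>\<^sup>+t. ennreal c * indicator {u..<v} t \<partial>lebesgue) = ennreal (c * (v - u))"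
  using assms by (subst nn_integral_cmult_indicator) (auto simp: ennreal_mult)

text \<open>
  The step functions \<open>k n\<close> are the \<open>p\<close>-th powers of the difference quotients of \<open>\<gamma>\<close> over \<open>n + 1\<close>
  equal intervals. Their lower limit \<open>K\<close> is integrable by Fatou's lemma, and \<open>G = K\<^sup>1\<^sup>/\<^sup>p\<close> dominates the
  derivative of \<open>dist (\<gamma> \<cdot>) z\<close> almost everywhere. The exceptional set depends on \<open>z\<close> but \<open>G\<close> does
  not, so \<open>z = \<gamma> x\<close> may be chosen at the end.
\<close>

lemma AC_of_uniform_difference_quotient_bound:
  fixes \<gamma> :: "real \<Rightarrow> 'x::metric_space"
  assumes ab: "a < b" and p: "1 \<le> p" "p \<noteq> \<infinity>" and cont: "continuous_on {a..b} \<gamma>"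
    and bound: "\<And>n. 0 < n \<Longrightarrow> (\<Sum>i<n. (dist (\<gamma> (node a b n i)) (\<gamma> (node a b n (Suc i))) / ((b - a) / n)) powr enn2real p * ((b - a) / n)) \<le> C"
    and dom: "\<And>z. \<exists>g. integrable (lebesgue_on {a..b}) g \<and> (\<forall>t\<in>{a..b}. 0 \<le> g t) \<and>
      (\<forall>x y. a \<le> x \<and> x \<le> y \<and> y \<le> b \<longrightarrow> \<bar>dist (\<gamma> x) z - dist (\<gamma> y) z\<bar> \<le> (LINT \<tau>:{x..y}|lebesgue. g \<tau>))"
  shows "\<gamma> \<in> AC p a b"
proof -
  define P where "P = enn2real p"
  have P: "1 \<le> P" unfolding P_def using p enn2real_mono[of 1 p] by (simp add: less_top)
  define \<delta> where "\<delta> n = (b - a) / real (Suc n)" for n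
  have \<delta>: "0 < \<delta> n" for n using ab by (simp add: \<delta>_def)
  define nd where "nd n i = node a b (Suc n) i" for n i
  have nd_Suc: "nd n (Suc i) = nd n i + \<delta> n" for n i by (simp add: nd_def \<delta>_def node_Suc)
  define q where "q n i = dist (\<gamma> (nd n i)) (\<gamma> (nd n (Suc i))) / \<delta> n" for n i
  have q0: "0 \<le> q n i" for n i using \<delta>[of n] by (simp add: q_def)
  define k where "k n t = (\<Sum>i<Suc n. ennreal (q n i powr P) * indicator {nd n i..<nd n (Suc i)} t)" for n t
  define K where "K t = liminf (\<lambda>n. k n t)" for t
  have km: "k n \<in> borel_measurable lebesgue" for n
    unfolding k_def by (intro borel_measurable_sum borel_measurable_times_ennreal borel_measurable_indicator) auto
  have kint: "(\<integral>\<^sup>+t. k n t \<partial>lebesgue) \<le> ennreal C" for n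
  proof -
    have "(\<integral>\<^sup>+t. k n t \<partial>lebesgue) = (\<Sum>i<Suc n. \<integral>\<^sup>+t. ennreal (q n i powr P) * indicator {nd n i..<nd n (Suc i)} t \<partial>lebesgue)"
      unfolding k_def by (intro nn_integral_sum borel_measurable_times_ennreal borel_measurable_indicator) auto
    also have "\<dots> = (\<Sum>i<Suc n. ennreal (q n i powr P * \<delta> n))"
      using \<delta>[of n] by (intro sum.cong refl) (simp add: nn_integral_const_indicator_Ico nd_Suc)
    also have "\<dots> = ennreal (\<Sum>i<Suc n. q n i powr P * \<delta> n)" using \<delta>[of n] by (intro sum_ennreal) auto
    also have "\<dots> \<le> ennreal C" using bound[of "Suc n"] by (intro ennreal_leI) (simp add: q_def nd_def \<delta>_def P_def)
    finally show ?thesis .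
  qed
  have Km: "K \<in> borel_measurable lebesgue" unfolding K_def using km by measurable
  have Kint: "(\<integral>\<^sup>+t. K t \<partial>lebesgue) \<le> ennreal C"
  proof -
    have "(\<integral>\<^sup>+t. K t \<partial>lebesgue) \<le> liminf (\<lambda>n. \<integral>\<^sup>+t. k n t \<partial>lebesgue)"
      unfolding K_def by (rule nn_integral_liminf[OF km])
    also have "\<dots> \<le> ennreal C"
      using Liminf_mono[of "\<lambda>n. \<integral>\<^sup>+t. k n t \<partial>lebesgue" "\<lambda>_. ennreal C" sequentially] kint by (simp add: Liminf_const)
    finally show ?thesis .
  qed
  have Kfin: "AE t in lebesgue. K t \<noteq> \<infinity>"
    using Kint Km by (intro nn_integral_PInf_AE) (auto simp: top_unique)
  define G where "G t = enn2real (K t) powr (1 / P)" for t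
  have G0: "0 \<le> G t" for t by (simp add: G_def)
  have GP: "\<bar>G t\<bar> powr P = enn2real (K t)" for t using P by (simp add: G_def powr_powr)
  have Gm: "G \<in> borel_measurable lebesgue" unfolding G_def using Km by measurable
  have "integrable lebesgue (\<lambda>t. enn2real (K t))"
  proof (rule integrableI_nonneg)
    show "(\<lambda>t. enn2real (K t)) \<in> borel_measurable lebesgue" using Km by measurable
    have "(\<integral>\<^sup>+t. ennreal (enn2real (K t)) \<partial>lebesgue) \<le> (\<integral>\<^sup>+t. K t \<partial>lebesgue)"
      by (intro nn_integral_mono) (simp add: ennreal_enn2real_if)
    then show "(\<integral>\<^sup>+t. ennreal (enn2real (K t)) \<partial>lebesgue) < \<infinity>"
      using Kint by (metis ennreal_less_top infinity_ennreal_def le_less_trans)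
  qed auto
  then have "integrable (lebesgue_on {a..b}) (\<lambda>t. \<bar>G t\<bar> powr P)"
    unfolding GP by (subst integrable_restrict_space) (auto intro: integrable_real_mult_indicator simp: mult.commute)
  then have GLp: "G \<in> Lp p a b"
    using p(2) Gm measurable_restrict_space1[OF Gm, of "{a..b}"] by (simp add: Lp_def P_def)
  have Gint: "integrable (lebesgue_on {a..b}) G" by (rule Lp_integrable[OF GLp p(1)])
  have slope: "\<bar>dist (\<gamma> x) z - dist (\<gamma> y) z\<bar> \<le> (LINT \<tau>:{x..y}|lebesgue. G \<tau>)" if xy: "a \<le> x" "x \<le> y" "y \<le> b" for x y z
  proof -
    define f where "f x = dist (\<gamma> x) z" for x
    obtain \<phi> where \<phi>: "integrable (lebesgue_on {a..b}) \<phi>"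
      and f\<phi>: "\<And>x y. a \<le> x \<Longrightarrow> x \<le> y \<Longrightarrow> y \<le> b \<Longrightarrow> f y - f x = (LINT \<tau>:{x..y}|lebesgue. \<phi> \<tau>)"
    proof -
      obtain g where g: "integrable (lebesgue_on {a..b}) g" "\<And>t. t \<in> {a..b} \<Longrightarrow> 0 \<le> g t"
        "\<And>x y. a \<le> x \<Longrightarrow> x \<le> y \<Longrightarrow> y \<le> b \<Longrightarrow> \<bar>f x - f y\<bar> \<le> (LINT \<tau>:{x..y}|lebesgue. g \<tau>)"
        using dom[of z] unfolding f_def by blast
      show ?thesis using dominated_function_is_integral[OF ab g] that by blast
    qed
    obtain N where N: "negligible N" and diff: "\<And>t \<epsilon>. t \<notin> N \<Longrightarrow> 0 < \<epsilon> \<Longrightarrow>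
      \<exists>d>0. \<forall>u v. a \<le> u \<and> u \<le> t \<and> t \<le> v \<and> v \<le> b \<and> u < v \<and> v - u < d \<longrightarrow>
        \<bar>(LINT \<tau>:{u..v}|lebesgue. \<phi> \<tau>) / (v - u) - \<phi> t\<bar> \<le> \<epsilon>"
      using lebesgue_differentiation_interval[OF \<phi>] by blast
    have pt: "ennreal (\<bar>\<phi> t\<bar> powr P) \<le> K t" if t: "t \<notin> N" "a \<le> t" "t < b" for t
    proof -
      \<comment> \<open>The interval of the \<open>n\<close>-th partition that contains \<open>t\<close>.\<close>
      define i where "i n = nat \<lfloor>(t - a) / \<delta> n\<rfloor>" for n
      have i: "i n < Suc n" "nd n (i n) \<le> t" "t < nd n (Suc (i n))" "a \<le> nd n (i n)" "nd n (Suc (i n)) \<le> b" for n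
      proof -
        have "0 \<le> (t - a) / \<delta> n" using t \<delta>[of n] by simp
        then have fl: "real (i n) \<le> (t - a) / \<delta> n" "(t - a) / \<delta> n < real (i n) + 1"
          unfolding i_def by (simp_all add: of_nat_floor)
        have "(t - a) / \<delta> n < (b - a) / \<delta> n" using t \<delta>[of n] by (intro divide_strict_right_mono) auto
        also have "\<dots> = real (Suc n)" using ab by (simp add: \<delta>_def)
        finally have "real (i n) < real (Suc n)" using fl(1) by linarith
        then show iS: "i n < Suc n" by linarith
        have e: "nd n j = a + real j * \<delta> n" for j by (simp add: nd_def node_def \<delta>_def)
        show "nd n (i n) \<le> t" unfolding e using fl(1) \<delta>[of n] by (simp add: pos_le_divide_eq)
        show "t < nd n (Suc (i n))" unfolding e using fl(2) \<delta>[of n] by (simp add: pos_divide_less_eq algebra_simps)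
        show "a \<le> nd n (i n)" "nd n (Suc (i n)) \<le> b"
          unfolding nd_def using iS by (intro node_bounds ab; simp)+
      qed
      define s where "s n = (f (nd n (Suc (i n))) - f (nd n (i n))) / \<delta> n" for n
      have "s \<longlonglongrightarrow> \<phi> t"
      proof (rule LIMSEQ_I)
        fix r :: real assume r: "0 < r"
        from diff[OF t(1), of "r / 2"] r obtain d where d: "d > 0"
          and D: "\<And>u v. a \<le> u \<Longrightarrow> u \<le> t \<Longrightarrow> t \<le> v \<Longrightarrow> v \<le> b \<Longrightarrow> u < v \<Longrightarrow> v - u < d \<Longrightarrow>
            \<bar>(LINT \<tau>:{u..v}|lebesgue. \<phi> \<tau>) / (v - u) - \<phi> t\<bar> \<le> r / 2" by auto
        obtain m :: nat where m: "(b - a) / d < real m" using reals_Archimedean2 by blast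
        have "norm (s n - \<phi> t) < r" if n: "n \<ge> m" for n
        proof -
          have "(b - a) / d < real (Suc n)" using m n by linarith
          then have \<delta>d: "\<delta> n < d" using d by (simp add: \<delta>_def field_simps)
          have w: "nd n (Suc (i n)) - nd n (i n) = \<delta> n" by (simp add: nd_Suc)
          have "s n = (LINT \<tau>:{nd n (i n)..nd n (Suc (i n))}|lebesgue. \<phi> \<tau>) / (nd n (Suc (i n)) - nd n (i n))"
            unfolding s_def w using f\<phi>[of "nd n (i n)" "nd n (Suc (i n))"] i[of n] by simp
          then have "\<bar>s n - \<phi> t\<bar> \<le> r / 2"
            using D[of "nd n (i n)" "nd n (Suc (i n))"] i[of n] w \<delta>d by simp
          then show ?thesis using r by simp
        qed
        then show "\<exists>m. \<forall>n\<ge>m. norm (s n - \<phi> t) < r" by blast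
      qed
      then have "(\<lambda>n. ennreal (\<bar>s n\<bar> powr P)) \<longlonglongrightarrow> ennreal (\<bar>\<phi> t\<bar> powr P)"
        using P by (intro tendsto_ennrealI tendsto_powr2 tendsto_rabs tendsto_const) auto
      then have "ennreal (\<bar>\<phi> t\<bar> powr P) = liminf (\<lambda>n. ennreal (\<bar>s n\<bar> powr P))"
        by (rule lim_imp_Liminf[OF trivial_limit_sequentially, symmetric])
      also have "\<dots> \<le> K t" unfolding K_def
      proof (rule Liminf_mono, rule always_eventually, rule allI)
        fix n
        have "\<bar>f (nd n (Suc (i n))) - f (nd n (i n))\<bar> \<le> dist (\<gamma> (nd n (i n))) (\<gamma> (nd n (Suc (i n))))"
          unfolding f_def
          using lipschitz_onD[OF lipschitz_on_dist[of z], of "\<gamma> (nd n (Suc (i n)))" "\<gamma> (nd n (i n))"]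
          by (simp add: dist_real_def dist_commute)
        then have "\<bar>s n\<bar> \<le> q n (i n)" using \<delta>[of n] by (simp add: s_def q_def abs_divide divide_right_mono)
        then have "ennreal (\<bar>s n\<bar> powr P) \<le> ennreal (q n (i n) powr P)"
          using P by (intro ennreal_leI powr_mono2) auto
        also have "\<dots> = ennreal (q n (i n) powr P) * indicator {nd n (i n)..<nd n (Suc (i n))} t"
          using i[of n] by simp
        also have "\<dots> \<le> k n t" unfolding k_def
          using i(1)[of n] by (intro member_le_sum[of "i n" "{..<Suc n}"
            "\<lambda>i. ennreal (q n i powr P) * indicator {nd n i..<nd n (Suc i)} t"]) auto
        finally show "ennreal (\<bar>s n\<bar> powr P) \<le> k n t" .
      qed
      finally show ?thesis .
    qed
    have le: "AE t in lebesgue. t \<in> {x..y} \<longrightarrow> \<bar>\<phi> t\<bar> \<le> G t"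
    proof -
      have "AE t in lebesgue. t \<notin> N" using N by (simp add: negligible_iff_null_sets AE_not_in)
      moreover have "AE t in lebesgue. t \<noteq> b" by (intro AE_completion AE_lborel_singleton)
      ultimately show ?thesis using Kfin
      proof eventually_elim
        case (elim t)
        show ?case
        proof
          assume "t \<in> {x..y}"
          then have "ennreal (\<bar>\<phi> t\<bar> powr P) \<le> K t" using elim xy by (intro pt) auto
          then have "\<bar>\<phi> t\<bar> powr P \<le> enn2real (K t)" using elim by (metis enn2real_ennreal enn2real_mono infinity_ennreal_def less_top powr_ge_zero)
          then have "(\<bar>\<phi> t\<bar> powr P) powr (1 / P) \<le> G t" unfolding G_def using P by (intro powr_mono2) auto
          then show "\<bar>\<phi> t\<bar> \<le> G t" using P by (simp add: powr_powr)
        qed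
      qed
    qed
    have si: "set_integrable lebesgue {x..y} \<phi>" "set_integrable lebesgue {x..y} G"
      using \<phi> Gint xy by (auto intro: set_integrable_lebesgue_subinterval)
    have "\<bar>f x - f y\<bar> = \<bar>LINT \<tau>:{x..y}|lebesgue. \<phi> \<tau>\<bar>" using f\<phi>[OF xy] by simp
    also have "\<dots> \<le> (\<integral>\<tau>. \<bar>indicator {x..y} \<tau> * \<phi> \<tau>\<bar> \<partial>lebesgue)"
      unfolding set_lebesgue_integral_def real_scaleR_def by (rule integral_abs_bound)
    also have "\<dots> \<le> (LINT \<tau>:{x..y}|lebesgue. G \<tau>)"
      unfolding set_lebesgue_integral_def real_scaleR_def
    proof (rule integral_mono_AE)
      show "integrable lebesgue (\<lambda>\<tau>. \<bar>indicator {x..y} \<tau> * \<phi> \<tau>\<bar>)"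
        using si(1) by (intro integrable_abs) (simp add: set_integrable_def)
      show "integrable lebesgue (\<lambda>\<tau>. indicator {x..y} \<tau> * G \<tau>)" using si(2) by (simp add: set_integrable_def)
      show "AE \<tau> in lebesgue. \<bar>indicator {x..y} \<tau> * \<phi> \<tau>\<bar> \<le> indicator {x..y} \<tau> * G \<tau>"
        using le by eventually_elim (auto simp: indicator_def)
    qed
    finally show ?thesis by (simp add: f_def)
  qed
  have "dist (\<gamma> x) (\<gamma> y) \<le> (LINT \<tau>:{x..y}|lebesgue. G \<tau>)" if xy: "a \<le> x" "x \<le> y" "y \<le> b" for x y
    using slope[OF xy, of "\<gamma> x"] by (simp add: dist_commute)
  then show ?thesis unfolding AC_def using GLp G0 by blast
qed

section \<open>The characterisation\<close>

lemma AC_infinity_of_lipschitz_compositions: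
  fixes \<gamma> :: "real \<Rightarrow> 'x::metric_space"
  assumes comp: "\<And>L h. L-lipschitz_on UNIV (h :: 'x \<Rightarrow> real) \<Longrightarrow> h \<circ> \<gamma> \<in> AC \<infinity> a b"
  shows "\<gamma> \<in> AC \<infinity> a b"
proof -
  define T where "T s t h = \<bar>h (\<gamma> s) - h (\<gamma> t)\<bar> / (t - s)" for s t and h :: "'x \<Rightarrow> real"
  define \<Theta> where "\<Theta> = {T s t | s t. a \<le> s \<and> s < t \<and> t \<le> b}"
  have "\<exists>C. \<forall>F\<in>\<Theta>. \<forall>f. 1-lipschitz_on UNIV f \<longrightarrow> F f \<le> C"
  proof (rule lipschitz_uniform_boundedness)
    fix F and f g :: "'x \<Rightarrow> real" assume "F \<in> \<Theta>"
    then obtain s t where F: "F = T s t" "s < t" by (auto simp: \<Theta>_def)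
    show "F (\<lambda>x. f x + g x) \<le> F f + F g"
      unfolding F(1) T_def add_divide_distrib[symmetric] using F(2) by (intro divide_right_mono) auto
  next
    fix F and f :: "'x \<Rightarrow> real" and c :: real assume "F \<in> \<Theta>"
    then obtain s t where F: "F = T s t" by (auto simp: \<Theta>_def)
    show "F (\<lambda>x. c * f x) = \<bar>c\<bar> * F f"
      unfolding F T_def right_diff_distrib[symmetric] abs_mult by simp
  next
    fix F assume "F \<in> \<Theta>"
    then obtain s t where F: "F = T s t" "s < t" by (auto simp: \<Theta>_def)
    have "F f \<le> dist (\<gamma> s) (\<gamma> t) / (t - s) * L" if f: "L-lipschitz_on UNIV f" for L f
      using lipschitz_onD[OF f, of "\<gamma> s" "\<gamma> t"] F(2)
      by (simp add: F(1) T_def dist_real_def divide_right_mono mult.commute)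
    then show "\<exists>B. \<forall>L f. L-lipschitz_on UNIV f \<longrightarrow> F f \<le> B * L" by blast
  next
    fix L and h :: "'x \<Rightarrow> real" assume "L-lipschitz_on UNIV h"
    from comp[OF this] obtain g where g: "g \<in> Lp \<infinity> a b"
      and gi: "\<And>s t. a \<le> s \<Longrightarrow> s \<le> t \<Longrightarrow> t \<le> b \<Longrightarrow> dist (h (\<gamma> s)) (h (\<gamma> t)) \<le> (LINT \<tau>:{s..t}|lebesgue. g \<tau>)"
      unfolding AC_def by auto
    obtain B where B: "AE t in lebesgue_on {a..b}. \<bar>g t\<bar> \<le> B" using g by (auto simp: Lp_def)
    have gint: "integrable (lebesgue_on {a..b}) g" by (rule Lp_integrable[OF g]) simp
    have "T s t h \<le> B" if st: "a \<le> s" "s < t" "t \<le> b" for s t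
    proof -
      have "dist (h (\<gamma> s)) (h (\<gamma> t)) \<le> (LINT \<tau>:{s..t}|lebesgue. g \<tau>)" using st by (intro gi) auto
      also have "\<dots> \<le> (LINT \<tau>:{s..t}|lebesgue. B)"
        unfolding set_lebesgue_integral_def
      proof (rule integral_mono_AE)
        show "integrable lebesgue (\<lambda>\<tau>. indicat_real {s..t} \<tau> *\<^sub>R g \<tau>)"
          using set_integrable_lebesgue_subinterval[OF gint st(1,3)] by (simp add: set_integrable_def)
        have "set_integrable lebesgue {s..t} (\<lambda>_. B)"
          by (rule set_integrable_lebesgue_subinterval[of a b]) (use st in auto)
        then show "integrable lebesgue (\<lambda>\<tau>. indicat_real {s..t} \<tau> *\<^sub>R B)" by (simp add: set_integrable_def)
        have "AE \<tau> in lebesgue. \<tau> \<in> {a..b} \<longrightarrow> \<bar>g \<tau>\<bar> \<le> B"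
          using B by (subst (asm) AE_restrict_space_iff) auto
        then show "AE \<tau> in lebesgue. indicat_real {s..t} \<tau> *\<^sub>R g \<tau> \<le> indicat_real {s..t} \<tau> *\<^sub>R B"
          by eventually_elim (use st in \<open>auto simp: indicator_def\<close>)
      qed
      also have "\<dots> = B * (t - s)" using st by (simp add: set_lebesgue_integral_def)
      finally show ?thesis using st by (simp add: T_def dist_real_def pos_divide_le_eq)
    qed
    then show "\<exists>B. \<forall>F\<in>\<Theta>. F h \<le> B" by (auto simp: \<Theta>_def)
  qed
  then obtain C where C: "\<And>s t f. a \<le> s \<Longrightarrow> s < t \<Longrightarrow> t \<le> b \<Longrightarrow> 1-lipschitz_on UNIV f \<Longrightarrow> T s t f \<le> C"
    unfolding \<Theta>_def by blast
  have "dist (\<gamma> s) (\<gamma> t) \<le> (LINT \<tau>:{s..t}|lebesgue. \<bar>C\<bar>)" if st: "a \<le> s" "s \<le> t" "t \<le> b" for s t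
  proof (cases "s = t")
    case False
    then have "s < t" using st by simp
    from C[OF st(1) this st(3) lipschitz_on_dist[of "\<gamma> s"]] this have "dist (\<gamma> s) (\<gamma> t) \<le> C * (t - s)"
      by (simp add: T_def pos_divide_le_eq dist_commute)
    also have "\<dots> \<le> \<bar>C\<bar> * (t - s)" using st by (intro mult_right_mono) auto
    also have "\<dots> = (LINT \<tau>:{s..t}|lebesgue. \<bar>C\<bar>)" using st by (simp add: set_lebesgue_integral_def)
    finally show ?thesis .
  qed (simp add: set_lebesgue_integral_def)
  moreover have "(\<lambda>_. \<bar>C\<bar>) \<in> Lp \<infinity> a b" by (auto simp: Lp_def)
  ultimately show ?thesis unfolding AC_def by (auto intro!: bexI[of _ "\<lambda>_. \<bar>C\<bar>"])
qed

lemma AC_finite_of_lipschitz_compositions: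
  fixes \<gamma> :: "real \<Rightarrow> 'x::metric_space"
  assumes ab: "a < b" and p: "1 \<le> p" "p \<noteq> \<infinity>"
    and comp: "\<And>L h. L-lipschitz_on UNIV (h :: 'x \<Rightarrow> real) \<Longrightarrow> h \<circ> \<gamma> \<in> AC p a b"
  shows "\<gamma> \<in> AC p a b"
proof -
  have P: "1 \<le> enn2real p" using p enn2real_mono[of 1 p] by (simp add: less_top)
  have dom: "\<exists>g. integrable (lebesgue_on {a..b}) g \<and> integrable (lebesgue_on {a..b}) (\<lambda>t. \<bar>g t\<bar> powr enn2real p) \<and>
        (\<forall>t\<in>{a..b}. 0 \<le> g t) \<and>
        (\<forall>u v x y. a \<le> u \<and> v \<le> b \<and> x \<in> {u..v} \<and> y \<in> {u..v} \<longrightarrow>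
          \<bar>h (\<gamma> x) - h (\<gamma> y)\<bar> \<le> (LINT \<tau>:{u..v}|lebesgue. g \<tau>))"
    if h: "L-lipschitz_on UNIV h" for L and h :: "'x \<Rightarrow> real"
  proof -
    from comp[OF h] obtain g where g: "g \<in> Lp p a b" and g0: "\<And>t. t \<in> {a..b} \<Longrightarrow> 0 \<le> g t"
      and gi: "\<And>s t. a \<le> s \<Longrightarrow> s \<le> t \<Longrightarrow> t \<le> b \<Longrightarrow> dist (h (\<gamma> s)) (h (\<gamma> t)) \<le> (LINT \<tau>:{s..t}|lebesgue. g \<tau>)"
      unfolding AC_def by auto
    have gint: "integrable (lebesgue_on {a..b}) g" by (rule Lp_integrable[OF g p(1)])
    have "\<bar>h (\<gamma> x) - h (\<gamma> y)\<bar> \<le> (LINT \<tau>:{u..v}|lebesgue. g \<tau>)"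
      if "a \<le> u" "v \<le> b" "x \<in> {u..v}" "y \<in> {u..v}" for u v x y
      by (rule AC_real_increment[of a b g "\<lambda>t. h (\<gamma> t)"]) (fact gint g0 gi that)+
    moreover have "integrable (lebesgue_on {a..b}) (\<lambda>t. \<bar>g t\<bar> powr enn2real p)"
      using g p(2) by (simp add: Lp_def)
    ultimately show ?thesis using gint g0 by (intro exI[of _ g]) simp
  qed
  have dom': "\<exists>g. integrable (lebesgue_on {a..b}) g \<and> (\<forall>t\<in>{a..b}. 0 \<le> g t) \<and>
      (\<forall>x y. a \<le> x \<and> x \<le> y \<and> y \<le> b \<longrightarrow> \<bar>dist (\<gamma> x) z - dist (\<gamma> y) z\<bar> \<le> (LINT \<tau>:{x..y}|lebesgue. g \<tau>))" for z
  proof -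
    from dom[OF lipschitz_on_dist[of z]] obtain g where "integrable (lebesgue_on {a..b}) g" "\<forall>t\<in>{a..b}. 0 \<le> g t"
      and g: "\<And>u v x y. a \<le> u \<Longrightarrow> v \<le> b \<Longrightarrow> x \<in> {u..v} \<Longrightarrow> y \<in> {u..v} \<Longrightarrow>
          \<bar>dist (\<gamma> x) z - dist (\<gamma> y) z\<bar> \<le> (LINT \<tau>:{u..v}|lebesgue. g \<tau>)" by blast
    moreover have "\<bar>dist (\<gamma> x) z - dist (\<gamma> y) z\<bar> \<le> (LINT \<tau>:{x..y}|lebesgue. g \<tau>)" if "a \<le> x" "x \<le> y" "y \<le> b" for x y
      using that by (intro g) auto
    ultimately show ?thesis by (intro exI[of _ g]) simp
  qed
  have cont: "continuous_on {a..b} \<gamma>"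
    by (rule continuous_on_if_dominated_by_integral) (unfold dist_real_def, rule dom')
  have "\<exists>C. \<forall>n>0. (\<Sum>i<n. (dist (\<gamma> (node a b n i)) (\<gamma> (node a b n (Suc i))) / ((b - a) / n)) powr enn2real p * ((b - a) / n)) \<le> C"
    by (rule uniform_difference_quotient_bound[OF ab P cont]) (rule dom)
  then obtain C where C: "\<And>n. 0 < n \<Longrightarrow> (\<Sum>i<n. (dist (\<gamma> (node a b n i)) (\<gamma> (node a b n (Suc i))) / ((b - a) / n)) powr enn2real p * ((b - a) / n)) \<le> C"
    by blast
  show ?thesis
    by (rule AC_of_uniform_difference_quotient_bound[OF ab p cont]) (fact C dom')+
qed

theorem theorem1p1:
  fixes a b :: real and p :: ennreal and \<gamma> :: "real \<Rightarrow> 'x::metric_space"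
  assumes "a < b" and "1 \<le> p"
  shows "\<gamma> \<in> AC p a b \<longleftrightarrow>
    (\<forall>h :: 'x \<Rightarrow> real. (\<exists>L>0. L-lipschitz_on UNIV h) \<longrightarrow> h \<circ> \<gamma> \<in> AC p a b)"
proof
  assume "\<gamma> \<in> AC p a b"
  then show "\<forall>h :: 'x \<Rightarrow> real. (\<exists>L>0. L-lipschitz_on UNIV h) \<longrightarrow> h \<circ> \<gamma> \<in> AC p a b"
    by (blast intro: AC_compose_lipschitz)
next
  assume H: "\<forall>h :: 'x \<Rightarrow> real. (\<exists>L>0. L-lipschitz_on UNIV h) \<longrightarrow> h \<circ> \<gamma> \<in> AC p a b"
  have comp: "h \<circ> \<gamma> \<in> AC p a b" if h: "L-lipschitz_on UNIV h" for L and h :: "'x \<Rightarrow> real"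
  proof -
    \<comment> \<open>A constant function has Lipschitz constant 0, but a positive one is required.\<close>
    have "(L + 1)-lipschitz_on UNIV h" using h by (rule lipschitz_on_mono) auto
    moreover have "0 < L + 1" using lipschitz_on_nonneg[OF h] by simp
    ultimately show ?thesis using H by blast
  qed
  show "\<gamma> \<in> AC p a b"
  proof (cases "p = \<infinity>")
    case True
    then show ?thesis using AC_infinity_of_lipschitz_compositions[of \<gamma> a b] comp by simp
  next
    case False
    then show ?thesis using AC_finite_of_lipschitz_compositions[OF assms] comp by blast
  qed
qed

end
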